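(* A finite-dimensional real Banach space $X$ can be U-embedded into $C(K)$ for some compact Hausdorff space $K$ if and only if $X$ admits a proper U-suitable set and its dual unit ball $B_{X^*}$ is a simplexoid.
   Context: $C(K)$ carries the sup norm. A linear isometry $T\colon X\to Y$ is a U-embedding if every $x^*\in X^*$ has a unique $y^*\in Y^*$ with $T^*(y^* )=x^*$ and $\|y^*\|=\|x^*\|$. For $x\in S_X$, $\mathfrak F(x):=\{x^*\in S_{X^*}:\langle x,x^*\rangle=1\}$. A closed $E\subset B_{X^*}$ is U-suitable if (i) $E\cap(-E)\cap S_{X^*}=\emptyset$ and (ii) $E\cup(-E)=\overline{\mathrm{Ext}\,B_{X^*}}$; it is proper if moreover (iii) $E\cap\mathfrak F(x)=E\cap\overline{\mathrm{Ext}\,\mathfrak F(x)}$ for every $x\in S_X$. A simplexoid is a compact convex set all of whose proper closed faces are simplices. *)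

theory Defs
  imports "HOL-Analysis.Analysis"
begin

definition is_simplex :: "'a::real_vector set \<Rightarrow> bool" where
  "is_simplex S \<longleftrightarrow> (\<exists>C. finite C \<and> \<not> affine_dependent C \<and> S = convex hull C)"

definition simplexoid :: "'a::real_normed_vector set \<Rightarrow> bool" where
  "simplexoid S \<longleftrightarrow> compact S \<and> convex S \<and>
     (\<forall>F. F face_of S \<and> F \<noteq> S \<and> closed F \<longrightarrow> is_simplex F)"

definition ext_pts :: "'a::real_vector set \<Rightarrow> 'a set" where
  "ext_pts S = {e. e extreme_point_of S}"

definition norming_set :: "'a::real_normed_vector \<Rightarrow> ('a \<Rightarrow>\<^sub>L real) set" where
  "norming_set x = {f. f \<in> sphere 0 1 \<and> blinfun_apply f x = 1}"

definition U_suitable :: "('a::real_normed_vector \<Rightarrow>\<^sub>L real) set \<Rightarrow> bool" where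
  "U_suitable E \<longleftrightarrow> closed E \<and> E \<subseteq> cball 0 1 \<and>
     E \<inter> uminus ` E \<inter> sphere 0 1 = {} \<and>
     E \<union> uminus ` E = closure (ext_pts (cball (0::'a \<Rightarrow>\<^sub>L real) 1))"

definition proper_U_suitable :: "('a::real_normed_vector \<Rightarrow>\<^sub>L real) set \<Rightarrow> bool" where
  "proper_U_suitable E \<longleftrightarrow> U_suitable E \<and>
     (\<forall>x::'a. norm x = 1 \<longrightarrow>
        E \<inter> norming_set x = E \<inter> closure (ext_pts (norming_set x)))"

text \<open>C(K): continuous real functions on the carrier of K, normalised to be 0 outside
  the carrier (so that C(K) is a set of functions with pointwise operations).\<close>
definition CK :: "'k topology \<Rightarrow> ('k \<Rightarrow> real) set" where
  "CK K = {f. continuous_map K euclideanreal f \<and> (\<forall>t. t \<notin> topspace K \<longrightarrow> f t = 0)}"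

definition supnorm :: "'k topology \<Rightarrow> ('k \<Rightarrow> real) \<Rightarrow> real" where
  "supnorm K f = Sup (insert 0 ((\<lambda>t. \<bar>f t\<bar>) ` topspace K))"

definition CK_dual :: "'k topology \<Rightarrow> (('k \<Rightarrow> real) \<Rightarrow> real) set" where
  "CK_dual K = {\<phi>. (\<forall>f\<in>CK K. \<forall>g\<in>CK K. \<phi> (\<lambda>t. f t + g t) = \<phi> f + \<phi> g) \<and>
                  (\<forall>f\<in>CK K. \<forall>c. \<phi> (\<lambda>t. c * f t) = c * \<phi> f) \<and>
                  (\<exists>M. \<forall>f\<in>CK K. \<bar>\<phi> f\<bar> \<le> M * supnorm K f)}"

definition CK_dual_norm :: "'k topology \<Rightarrow> (('k \<Rightarrow> real) \<Rightarrow> real) \<Rightarrow> real" where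
  "CK_dual_norm K \<phi> = Sup (insert 0 {\<bar>\<phi> f\<bar> | f. f \<in> CK K \<and> supnorm K f \<le> 1})"

text \<open>T : X \<rightarrow> C(K) is a U-embedding: a linear isometry such that every functional
  on X has a unique norm-preserving extension through T (functionals on C(K) being
  identified when they agree on C(K)).\<close>
definition U_embedding_CK :: "'k topology \<Rightarrow> ('a::real_normed_vector \<Rightarrow> ('k \<Rightarrow> real)) \<Rightarrow> bool" where
  "U_embedding_CK K T \<longleftrightarrow>
     (\<forall>x. T x \<in> CK K) \<and>
     (\<forall>x y. T (x + y) = (\<lambda>t. T x t + T y t)) \<and> (\<forall>c x. T (c *\<^sub>R x) = (\<lambda>t. c * T x t)) \<and> (\<forall>x. supnorm K (T x) = norm x) \<and>
     (\<forall>x'::'a \<Rightarrow>\<^sub>L real. \<exists>y'\<in>CK_dual K.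
        (\<forall>x. y' (T x) = blinfun_apply x' x) \<and> CK_dual_norm K y' = norm x' \<and>
        (\<forall>z'\<in>CK_dual K. (\<forall>x. z' (T x) = blinfun_apply x' x) \<and> CK_dual_norm K z' = norm x'
            \<longrightarrow> (\<forall>f\<in>CK K. z' f = y' f)))"

end

theory Submission
  imports Defs
begin

text \<open>
  Necessity. Evaluation at the points of \<open>K\<close> gives a compact set \<open>L \<subseteq> B\<^sub>X\<^sub>*\<close> such that
  \<open>L \<union> -L\<close> contains the extreme points of \<open>B\<^sub>X\<^sub>*\<close>. Every representation of a functional as a
  combination of elements of \<open>L\<close> with coefficients of total mass equal to its norm is a
  norm-preserving extension, so by uniqueness and Urysohn's lemma its coefficients are determined.
  Hence \<open>L\<close> and \<open>-L\<close> do not meet on the sphere, the norm-one elements of \<open>L\<close> are extreme, and the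
  extreme points of a proper face are affinely independent;
  \<open>E = L \<inter> closure (Ext B\<^sub>X\<^sub>*)\<close> is a proper U-suitable set.

  Sufficiency. Take \<open>K = E\<close>. If \<open>x\<^sup>*\<close> attains its norm at \<open>x\<close>, any norm-preserving extension is
  concentrated on the points of \<open>E\<close> where \<open>x\<close> takes the values \<open>1\<close> or \<open>-1\<close>. Up to sign these
  are distinct vertices of the simplex \<open>\<FF>(x)\<close>, so the masses are barycentric coordinates of
  (a multiple of) \<open>x\<^sup>*\<close> and therefore unique.
\<close>

section \<open>Linear embeddings into Euclidean spaces\<close>

text \<open>The bounded left inverse \<open>G\<close> lets compactness and convexity facts be pulled
  back from \<open>'n\<close>. The locale serves twice: for \<open>'a\<close> itself and for its
  dual.\<close>

locale euclidean_embedding =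
  fixes J :: "'b::real_normed_vector \<Rightarrow> 'n::euclidean_space" and G :: "'n \<Rightarrow> 'b"
  assumes bounded_linear_J: "bounded_linear J"
    and bounded_linear_G: "bounded_linear G"
    and G_J [simp]: "G (J x) = x"
begin

lemma linear_J: "linear J"
  using bounded_linear_J by (rule bounded_linear.linear)

lemma inj_J: "inj J"
  by (metis G_J injI)

lemma G_image_J_image [simp]: "G ` J ` S = S"
  by (simp add: image_image)

lemma compact_J_image_iff: "compact (J ` S) \<longleftrightarrow> compact S"
proof
  assume "compact (J ` S)"
  then have "compact (G ` J ` S)"
    using linear_continuous_on[OF bounded_linear_G] compact_continuous_image by blast
  then show "compact S"
    by simp
next
  assume "compact S"
  then show "compact (J ` S)"
    by (intro compact_continuous_image linear_continuous_on bounded_linear_J)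
qed

text \<open>The image of the ball is the closed subspace \<open>range J\<close> cut by the closed
  set of points that \<open>G\<close> sends into the ball. It is also bounded, hence
  compact.\<close>

lemma compact_cball: "compact (cball (0::'b) 1)"
proof -
  have "J ` cball 0 1 = range J \<inter> G -` cball 0 1"
    by auto
  moreover have "closed (range J)"
    by (intro closed_subspace linear_subspace_image linear_J subspace_UNIV)
  moreover have "closed (G -` cball 0 1)"
    by (intro closed_vimage closed_cball) (simp add: bounded_linear_G linear_continuous_on)
  ultimately have "closed (J ` cball 0 1)"
    by (simp add: closed_Int)
  moreover have "bounded (J ` cball 0 1)"
    by (intro bounded_linear_image bounded_cball bounded_linear_J)
  ultimately show ?thesis
    using compact_J_image_iff compact_eq_bounded_closed by blast
qed

lemma compact_convex_hull_embedded: "compact S \<Longrightarrow> compact (convex hull (S :: 'b set))"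
  using compact_J_image_iff convex_hull_linear_image[OF linear_J, of S] compact_convex_hull
  by metis

lemma extreme_point_of_J_image: "J x extreme_point_of J ` S \<longleftrightarrow> x extreme_point_of S"
  by (auto simp: extreme_point_of_def open_segment_linear_image[OF linear_J inj_J]
      inj_image_mem_iff[OF inj_J])

lemma Krein_Milman_Minkowski_embedded:
  assumes "compact S" "convex (S :: 'b set)"
  shows "S = convex hull {x. x extreme_point_of S}"
proof -
  have "{y. y extreme_point_of J ` S} = J ` {x. x extreme_point_of S}"
  proof (intro set_eqI iffI)
    fix y
    assume "y \<in> {y. y extreme_point_of J ` S}"
    then have y: "y extreme_point_of J ` S"
      by simp
    then obtain x where "y = J x"
      by (auto simp: extreme_point_of_def)
    with y show "y \<in> J ` {x. x extreme_point_of S}"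
      by (simp add: extreme_point_of_J_image)
  qed (auto simp: extreme_point_of_J_image)
  moreover have "J ` S = convex hull {y. y extreme_point_of J ` S}"
    by (intro Krein_Milman_Minkowski convex_linear_image linear_J assms)
       (simp add: compact_J_image_iff assms)
  ultimately have "J ` S = J ` (convex hull {x. x extreme_point_of S})"
    by (simp add: convex_hull_linear_image[OF linear_J])
  then show ?thesis
    using inj_J inj_image_eq_iff by blast
qed

text \<open>An infinite \<open>S\<close> has an infinite image, which is affinely dependent in
  Euclidean space; the coefficients of that dependency are carried back along
  \<open>J\<close>.\<close>

lemma affine_independent_imp_finite:
  assumes "\<not> affine_dependent (S :: 'b set)"
  shows "finite S"
proof (rule ccontr)
  assume "infinite S"
  then have "infinite (J ` S)"
    using finite_imageD inj_J inj_on_subset by blast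
  then have "affine_dependent (J ` S)"
    using aff_independent_finite by blast
  then obtain A U where A: "finite A" "A \<subseteq> J ` S" "sum U A = 0" "\<exists>v\<in>A. U v \<noteq> 0"
    "(\<Sum>v\<in>A. U v *\<^sub>R v) = 0"
    unfolding affine_dependent_explicit by blast
  obtain B where B: "B \<subseteq> S" "finite B" "A = J ` B"
    using finite_subset_image[OF A(1,2)] by blast
  have inj: "inj_on J B"
    using inj_J inj_on_subset by blast
  have "J (\<Sum>v\<in>B. U (J v) *\<^sub>R v) = (\<Sum>v\<in>B. U (J v) *\<^sub>R J v)"
    by (simp add: linear_sum[OF linear_J] linear_scale[OF linear_J])
  also have "\<dots> = 0"
    using A(5) B(3) inj by (simp add: sum.reindex)
  finally have "(\<Sum>v\<in>B. U (J v) *\<^sub>R v) = 0"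
    by (metis G_J linear_0 linear_J)
  moreover have "sum (\<lambda>v. U (J v)) B = 0"
    using A(3) B(3) inj by (simp add: sum.reindex)
  moreover have "\<exists>v\<in>B. U (J v) \<noteq> 0"
    using A(4) B(3) by blast
  ultimately have "affine_dependent S"
    unfolding affine_dependent_explicit using B by (intro exI[of _ B] exI[of _ "\<lambda>v. U (J v)"]) simp
  with assms show False ..
qed

end

text \<open>
  A typedef may depend on its type argument, so indexing coordinates by a finite spanning set of
  \<open>'a\<close> gives a genuine Euclidean space attached to \<open>'a\<close>; this makes the Euclidean
  library available although the dimension of \<open>'a\<close> is only known through a hypothesis.
  The default \<open>{0}\<close> is a junk value for infinite-dimensional \<open>'a\<close>.
\<close>

definition spanning_set :: "'a::real_vector set" where
  "spanning_set = (if \<exists>B::'a set. finite B \<and> span B = UNIV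
     then insert 0 (SOME B. finite B \<and> span B = UNIV) else {0})"

lemma finite_spanning_set: "finite (spanning_set :: 'a::real_vector set)"
proof (cases "\<exists>B::'a set. finite B \<and> span B = UNIV")
  case True
  then show ?thesis
    using someI_ex[OF True] by (simp add: spanning_set_def)
qed (auto simp: spanning_set_def)

lemma span_spanning_set:
  assumes "\<exists>B. finite B \<and> span B = (UNIV :: 'a::real_vector set)"
  shows "span spanning_set = (UNIV :: 'a set)"
  using someI_ex[OF assms] assms by (simp add: spanning_set_def)

text \<open>Nonemptiness comes from the \<open>0\<close> put into \<open>spanning_set\<close>: a
  spanning set of the zero space may be empty.\<close>

typedef (overloaded) ('a::real_vector) spanning_index = "spanning_set :: 'a set"
  unfolding spanning_set_def by auto

instance spanning_index :: (real_vector) finite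
proof
  have "UNIV = (Abs_spanning_index :: 'a \<Rightarrow> _) ` spanning_set"
    using type_definition.univ[OF type_definition_spanning_index] .
  then show "finite (UNIV :: 'a spanning_index set)"
    using finite_spanning_set finite_imageI by metis
qed

definition combination :: "real ^ 'a spanning_index \<Rightarrow> 'a::real_vector" where
  "combination v = (\<Sum>i\<in>UNIV. (v $ i) *\<^sub>R Rep_spanning_index i)"

lemma linear_combination: "linear combination"
  by (rule linearI)
     (simp_all add: combination_def scaleR_add_left sum.distrib scaleR_sum_right)

lemma surj_combination:
  assumes "\<exists>B. finite B \<and> span B = (UNIV :: 'a::real_vector set)"
  shows "surj (combination :: _ \<Rightarrow> 'a)"
proof -
  have "x \<in> range combination" for x :: 'a
  proof -
    have "spanning_set \<subseteq> range (combination :: _ \<Rightarrow> 'a)"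
    proof
      fix b :: 'a
      assume "b \<in> spanning_set"
      then obtain i where i: "b = Rep_spanning_index i"
        by (metis Rep_spanning_index_cases)
      have "combination (axis i 1) = (\<Sum>j\<in>UNIV. (if j = i then Rep_spanning_index j else 0))"
        unfolding combination_def by (rule sum.cong) (auto simp: axis_def)
      then have "combination (axis i 1) = b"
        using i by simp
      then show "b \<in> range combination"
        by blast
    qed
    moreover have "subspace (range (combination :: _ \<Rightarrow> 'a))"
      by (intro linear_subspace_image linear_combination subspace_UNIV)
    ultimately have "span spanning_set \<subseteq> range (combination :: _ \<Rightarrow> 'a)"
      by (rule span_minimal)
    then show ?thesis
      using span_spanning_set[OF assms] by auto
  qed
  then show ?thesis
    by auto
qed

text \<open>On the compact set of unit vectors in \<open>range k\<close> the map \<open>h\<close>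
  does not vanish, so \<open>norm (h v)\<close> has a positive lower bound \<open>m\<close> there.
  Rescaling turns this into the bound \<open>1 / m\<close> for \<open>k\<close>.\<close>

lemma bounded_linear_section:
  fixes h :: "'n::euclidean_space \<Rightarrow> 'a::real_normed_vector"
  assumes h: "linear h" and k: "linear k" and hk: "\<And>x. h (k x) = x"
  shows "bounded_linear k"
proof -
  define S where "S = range k \<inter> sphere 0 1"
  have "closed (range k)"
    by (intro closed_subspace linear_subspace_image k subspace_UNIV)
  then have "compact S"
    unfolding S_def by (simp add: closed_Int_compact)
  moreover have "continuous_on S (\<lambda>v. norm (h v))"
    using h by (intro continuous_intros linear_continuous_on) (simp add: linear_conv_bounded_linear)
  ultimately obtain m where m: "m > 0" "\<And>v. v \<in> S \<Longrightarrow> m \<le> norm (h v)"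
  proof (cases "S = {}")
    case True
    then show ?thesis
      using that[of 1] by simp
  next
    case False
    then obtain v where v: "v \<in> S" "\<And>w. w \<in> S \<Longrightarrow> norm (h v) \<le> norm (h w)"
      using continuous_attains_inf[OF \<open>compact S\<close> _ \<open>continuous_on S _\<close>] by metis
    have "h v \<noteq> 0"
      using v(1) hk linear_0[OF k] by (auto simp: S_def)
    then show ?thesis
      using v that[of "norm (h v)"] by simp
  qed
  have "norm (k x) \<le> norm x * (1 / m)" for x
  proof (cases "k x = 0")
    case False
    have "k ((1 / norm (k x)) *\<^sub>R x) \<in> S"
      using False by (simp add: S_def linear_scale[OF k])
        (metis linear_scale[OF k] rangeI)
    then have "m \<le> norm ((1 / norm (k x)) *\<^sub>R x)"
      using m(2) hk by metis
    then show ?thesis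
      using False m(1) by (simp add: field_simps)
  next
    case True
    then show ?thesis
      using m(1) by simp
  qed
  then show ?thesis
    using k unfolding bounded_linear_def bounded_linear_axioms_def by blast
qed

lemma ex_euclidean_embedding:
  assumes "\<exists>B. finite B \<and> span B = (UNIV :: 'a::real_normed_vector set)"
  obtains k :: "'a::real_normed_vector \<Rightarrow> real ^ 'a spanning_index" where "euclidean_embedding k combination"
proof -
  obtain k :: "'a \<Rightarrow> real ^ 'a spanning_index" where k: "linear k" "combination \<circ> k = id"
    using linear_surjective_right_inverse[OF linear_combination surj_combination[OF assms]]
    by blast
  have hk: "combination (k x) = x" for x
    using k(2) by (metis comp_apply id_apply)
  have "euclidean_embedding k combination"
    using bounded_linear_section[OF linear_combination k(1) hk] hk
      linear_combination[where 'a = 'a, unfolded linear_conv_bounded_linear]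
    unfolding euclidean_embedding_def by blast
  then show ?thesis
    by (rule that)
qed

definition dual_coordinates :: "('a::real_normed_vector \<Rightarrow>\<^sub>L real) \<Rightarrow> real ^ 'a spanning_index" where
  "dual_coordinates f = (\<chi> i. blinfun_apply f (Rep_spanning_index i))"

text \<open>Hyperplanes in coordinate space are thus given by vectors of \<open>'a\<close>, so
  separation of sets of functionals is achieved by evaluation at a point.\<close>

lemma inner_dual_coordinates: "a \<bullet> dual_coordinates f = blinfun_apply f (combination a)"
  by (simp add: inner_vec_def dual_coordinates_def combination_def blinfun.sum_right
      blinfun.scaleR_right)

text \<open>A functional is determined by its values on a spanning set, so
  \<open>dual_coordinates\<close> is injective and has a linear left inverse;
  \<open>bounded_linear_section\<close> supplies continuity.\<close>

lemma ex_dual_embedding: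
  assumes "\<exists>B. finite B \<and> span B = (UNIV :: 'a::real_normed_vector set)"
  obtains G :: "real ^ 'a spanning_index \<Rightarrow> ('a::real_normed_vector \<Rightarrow>\<^sub>L real)" where "euclidean_embedding dual_coordinates G"
proof -
  have lin: "linear (dual_coordinates :: ('a \<Rightarrow>\<^sub>L real) \<Rightarrow> _)"
    by (rule linearI) (auto simp: dual_coordinates_def vec_eq_iff blinfun.add_left blinfun.scaleR_left)
  have "inj (dual_coordinates :: ('a \<Rightarrow>\<^sub>L real) \<Rightarrow> _)"
  proof (rule injI)
    fix f g :: "'a \<Rightarrow>\<^sub>L real"
    assume "dual_coordinates f = dual_coordinates g"
    then have "blinfun_apply f (combination a) = blinfun_apply g (combination a)" for a
      by (metis inner_dual_coordinates)
    then show "f = g"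
      using surj_combination[OF assms] by (metis blinfun_eqI surjD)
  qed
  then obtain G where G: "linear G" "G \<circ> dual_coordinates = (id :: ('a \<Rightarrow>\<^sub>L real) \<Rightarrow> _)"
    using linear_injective_left_inverse[OF lin] by blast
  have "bounded_linear (dual_coordinates :: ('a \<Rightarrow>\<^sub>L real) \<Rightarrow> _)"
    using G by (intro bounded_linear_section[OF G(1) lin]) (metis comp_apply id_apply)
  then have "euclidean_embedding dual_coordinates G"
    using G by (simp add: euclidean_embedding_def linear_conv_bounded_linear)
      (metis comp_apply id_apply)
  then show ?thesis
    by (rule that)
qed

section \<open>Duality in finite dimension\<close>

context
  fixes X_type :: "'a::real_normed_vector itself"
  assumes findim: "\<exists>B. finite B \<and> span B = (UNIV :: 'a set)"
begin

lemma compact_dual_ball: "compact (cball (0 :: 'a \<Rightarrow>\<^sub>L real) 1)"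
  using ex_dual_embedding[OF findim] euclidean_embedding.compact_cball by metis

lemma Krein_Milman_Minkowski_dual:
  fixes S :: "('a \<Rightarrow>\<^sub>L real) set"
  assumes "compact S" "convex S"
  shows "S = convex hull ext_pts S"
  using ex_dual_embedding[OF findim] euclidean_embedding.Krein_Milman_Minkowski_embedded assms
  unfolding ext_pts_def by metis

lemma finite_affine_independent_dual:
  fixes S :: "('a \<Rightarrow>\<^sub>L real) set"
  assumes "\<not> affine_dependent S"
  shows "finite S"
  using ex_dual_embedding[OF findim] euclidean_embedding.affine_independent_imp_finite assms by metis

lemma separate_point_dual:
  fixes S :: "('a \<Rightarrow>\<^sub>L real) set"
  assumes "compact S" "f \<notin> convex hull S"
  obtains x b where "\<And>g. g \<in> S \<Longrightarrow> blinfun_apply g x < b" "b < blinfun_apply f x"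
proof -
  obtain G where "euclidean_embedding (dual_coordinates :: ('a \<Rightarrow>\<^sub>L real) \<Rightarrow> _) G"
    using ex_dual_embedding[OF findim] by metis
  then interpret euclidean_embedding "dual_coordinates :: ('a \<Rightarrow>\<^sub>L real) \<Rightarrow> _" G .
  let ?C = "dual_coordinates ` (convex hull S)"
  have "convex ?C"
    by (simp add: convex_linear_image linear_J)
  moreover have "closed ?C"
    by (simp add: compact_J_image_iff compact_convex_hull_embedded assms compact_imp_closed)
  moreover have "dual_coordinates f \<notin> ?C"
    using assms(2) inj_J by (simp add: inj_image_mem_iff)
  ultimately obtain a b where ab: "a \<bullet> dual_coordinates f < b" "\<forall>y\<in>?C. b < a \<bullet> y"
    using separating_hyperplane_closed_point by metis
  \<comment> \<open>The separation theorem places the point below the set; negating \<open>a\<close>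
    and \<open>b\<close> reverses this.\<close>
  have "blinfun_apply g (combination (- a)) < - b" if "g \<in> S" for g
    using ab(2) that hull_inc[of g S convex]
    by (auto simp: inner_dual_coordinates linear_neg[OF linear_combination] blinfun.minus_right)
  moreover have "- b < blinfun_apply f (combination (- a))"
    using ab(1) by (simp add: inner_dual_coordinates linear_neg[OF linear_combination] blinfun.minus_right)
  ultimately show ?thesis
    using that by blast
qed

text \<open>A finite-dimensional Hahn-Banach argument: separate \<open>k x\<close> from the preimage
  of the open unit ball in coordinate space, then normalise the separating functional to take the
  value 1 at \<open>x\<close>.\<close>

lemma ex_norming_functional:
  fixes x :: 'a
  assumes "norm x = 1"
  obtains f where "f \<in> norming_set x"
proof -
  obtain k where "euclidean_embedding (k :: 'a \<Rightarrow> _) combination"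
    using ex_euclidean_embedding[OF findim] by metis
  then interpret euclidean_embedding "k :: 'a \<Rightarrow> _" combination .
  let ?D = "(\<lambda>v. combination v) -` ball (0::'a) 1"
  have cD: "convex ?D"
    by (intro convex_linear_vimage linear_combination convex_ball)
  have zero: "0 \<in> ?D"
    by (simp add: linear_0[OF linear_combination])
  have "k x \<notin> ?D"
    using assms by simp
  then obtain a c where ac: "a \<noteq> 0" "\<And>v. v \<in> ?D \<Longrightarrow> a \<bullet> v \<le> c" "c \<le> a \<bullet> k x"
    using separating_hyperplane_sets[of ?D "{k x}"] cD zero by fastforce
  have "open ?D"
    by (intro open_vimage open_ball) (simp add: bounded_linear_G linear_continuous_on)
  then obtain e where e: "e > 0" "ball 0 e \<subseteq> ?D"
    using zero open_contains_ball by blast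
  \<comment> \<open>A small positive multiple of \<open>a\<close> lies in \<open>?D\<close> and has
    positive inner product with \<open>a\<close>; this makes \<open>c\<close> positive and permits
    division by \<open>s\<close>.\<close>
  have "(e / (2 * norm a)) *\<^sub>R a \<in> ?D"
    using e ac(1) by (intro subsetD[OF e(2)]) (simp add: field_simps)
  from ac(2)[OF this] have "0 < c"
    using e(1) ac(1) by (simp add: dot_square_norm power2_eq_square)
      (smt (verit) mult_pos_pos zero_less_norm_iff)
  define s where "s = a \<bullet> k x"
  have s: "s > 0"
    using \<open>0 < c\<close> ac(3) by (simp add: s_def)
  define F where "F y = a \<bullet> k y / s" for y
  have blF: "bounded_linear F"
    unfolding F_def divide_inverse
    by (intro bounded_linear_intros bounded_linear_compose[OF bounded_linear_inner_right bounded_linear_J])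
  have less: "F y \<le> 1" if "norm y < 1" for y
    using ac(2)[of "k y"] ac(3) that s by (simp add: F_def s_def)
  have bound: "\<bar>F y\<bar> \<le> 1 * norm y" for y
  proof -
    have "F y \<le> norm y" for y
    proof (rule field_le_epsilon)
      fix \<delta> :: real
      assume "\<delta> > 0"
      then have p: "norm y + \<delta> > 0"
        by (smt (verit) norm_ge_zero)
      \<comment> \<open>Dividing by \<open>norm y + \<delta>\<close> lands strictly inside the ball,
        where \<open>less\<close> applies, and also covers \<open>y = 0\<close>.\<close>
      have "F ((1 / (norm y + \<delta>)) *\<^sub>R y) \<le> 1"
        using p \<open>\<delta> > 0\<close> by (intro less) (simp add: field_simps)
      then show "F y \<le> norm y + \<delta>"
        using p linear_scale[OF bounded_linear.linear[OF blF]] by (simp add: field_simps)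
    qed
    from this[of y] this[of "- y"] show ?thesis
      using linear_neg[OF bounded_linear.linear[OF blF]] by (simp add: abs_le_iff)
  qed
  have ap: "blinfun_apply (Blinfun F) = F"
    by (simp add: bounded_linear_Blinfun_apply blF)
  have one: "F x = 1"
    using s by (simp add: F_def s_def)
  have "norm (Blinfun F) \<le> 1"
    by (rule norm_blinfun_bound) (use bound ap in auto)
  moreover have "norm (Blinfun F) \<ge> 1"
    using norm_blinfun[of "Blinfun F" x] one assms ap by simp
  ultimately have "Blinfun F \<in> norming_set x"
    using one ap by (simp add: norming_set_def)
  then show ?thesis
    by (rule that)
qed

text \<open>The unit ball of \<open>'a\<close> is compact, so \<open>f\<close> has a maximiser on
  it. By homogeneity the maximum is \<open>norm f\<close>, and \<open>f \<noteq> 0\<close> forces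
  the maximiser onto the sphere.\<close>

lemma norm_attained:
  fixes f :: "'a \<Rightarrow>\<^sub>L real"
  assumes "f \<noteq> 0"
  obtains x where "norm x = 1" "blinfun_apply f x = norm f"
proof -
  have "compact (cball (0::'a) 1)"
    using ex_euclidean_embedding[OF findim] euclidean_embedding.compact_cball by metis
  then obtain x where x: "norm x \<le> 1" "\<And>y. norm y \<le> 1 \<Longrightarrow> blinfun_apply f y \<le> blinfun_apply f x"
    using continuous_attains_sup[of "cball 0 1" "blinfun_apply f"]
      linear_continuous_on[OF blinfun.bounded_linear_right] by fastforce
  have fx: "blinfun_apply f x \<ge> 0"
    using x(2)[of 0] by simp
  have "norm f \<le> blinfun_apply f x"
  proof (rule norm_blinfun_bound[OF fx])
    fix y
    have "\<bar>blinfun_apply f y\<bar> \<le> blinfun_apply f x * norm y" if "y \<noteq> 0"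
      using x(2)[of "(1 / norm y) *\<^sub>R y"] x(2)[of "(- 1 / norm y) *\<^sub>R y"] that
      by (simp add: blinfun.scaleR_right blinfun.minus_right field_simps abs_le_iff)
    then show "norm (blinfun_apply f y) \<le> blinfun_apply f x * norm y"
      by (cases "y = 0") auto
  qed
  moreover have "blinfun_apply f x \<le> norm f * norm x"
    using norm_blinfun[of f x] by simp
  ultimately have "norm f * 1 \<le> norm f * norm x" "blinfun_apply f x \<le> norm f * norm x"
    by simp_all
  then have "norm x = 1" "blinfun_apply f x = norm f"
    using x(1) assms \<open>norm f \<le> blinfun_apply f x\<close> by simp_all
  then show ?thesis
    by (rule that)
qed

text \<open>Krein-Milman applied to \<open>f / norm f\<close>, scaled back. The total mass
  \<open>norm f\<close> is what makes the resulting atomic functionals norm-preserving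
  extensions.\<close>

lemma dual_ball_combination:
  fixes f :: "'a \<Rightarrow>\<^sub>L real"
  obtains A c where "finite A" "A \<subseteq> ext_pts (cball (0 :: 'a \<Rightarrow>\<^sub>L real) 1)"
    "\<forall>w\<in>A. 0 \<le> c w" "sum c A = norm f" "(\<Sum>w\<in>A. c w *\<^sub>R w) = f"
proof (cases "f = 0")
  case True
  then show ?thesis
    using that[of "{}" "\<lambda>_. 0"] by simp
next
  case False
  then have "(1 / norm f) *\<^sub>R f \<in> convex hull ext_pts (cball (0 :: 'a \<Rightarrow>\<^sub>L real) 1)"
    using Krein_Milman_Minkowski_dual[OF compact_dual_ball convex_cball] by force
  then obtain A u where A: "finite A" "A \<subseteq> ext_pts (cball (0 :: 'a \<Rightarrow>\<^sub>L real) 1)"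
    "\<forall>w\<in>A. 0 \<le> u w" "sum u A = 1" "(\<Sum>w\<in>A. u w *\<^sub>R w) = (1 / norm f) *\<^sub>R f"
    unfolding convex_hull_explicit by blast
  have "(\<Sum>w\<in>A. (norm f * u w) *\<^sub>R w) = norm f *\<^sub>R (\<Sum>w\<in>A. u w *\<^sub>R w)"
    by (simp add: scaleR_sum_right)
  also have "\<dots> = f"
    using A(5) False by simp
  finally show ?thesis
    using that[of A "\<lambda>w. norm f * u w"] A by (simp flip: sum_distrib_left)
qed

end

section \<open>Norming sets and proper faces of the unit ball\<close>

lemma norming_set_eq:
  assumes "norm x = 1"
  shows "norming_set x = {f \<in> cball 0 1. blinfun_apply f x = 1}"
proof -
  have "1 \<le> norm f" if "blinfun_apply f x = 1" for f :: "_ \<Rightarrow>\<^sub>L real"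
    using norm_blinfun[of f x] that assms by simp
  then show ?thesis
    by (force simp: norming_set_def)
qed

lemma closed_norming_set: "closed (norming_set x)"
proof -
  have "norming_set x = norm -` {1} \<inter> (\<lambda>f. blinfun_apply f x) -` {1}"
    by (auto simp: norming_set_def)
  also have "closed \<dots>"
    by (intro closed_Int closed_vimage closed_singleton continuous_intros
        linear_continuous_on blinfun.bounded_linear_left)
  finally show ?thesis .
qed

text \<open>Evaluation at \<open>x\<close> is at most 1 on the ball, so a proper convex combination
  of two values reaches 1 only if both values are 1.\<close>

lemma norming_set_face_of:
  assumes "norm x = 1"
  shows "norming_set x face_of cball 0 1"
  unfolding face_of_def
proof (intro conjI ballI impI)
  show "norming_set x \<subseteq> cball 0 1"
    by (auto simp: norming_set_def)
  show "convex (norming_set x)"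
  proof -
    have "norming_set x = cball 0 1 \<inter> (\<lambda>f. blinfun_apply f x) -` {1}"
      using norming_set_eq[OF assms] by auto
    then show ?thesis
      by (simp add: convex_Int convex_linear_vimage blinfun.bounded_linear_left bounded_linear.linear)
  qed
  fix a b f
  assume ab: "a \<in> cball 0 1" "b \<in> cball 0 1" and f: "f \<in> norming_set x" "f \<in> open_segment a b"
  then obtain u where u: "0 < u" "u < 1" "f = (1 - u) *\<^sub>R a + u *\<^sub>R b"
    by (auto simp: in_segment)
  have le: "blinfun_apply a x \<le> 1" "blinfun_apply b x \<le> 1"
    using norm_blinfun[of a x] norm_blinfun[of b x] ab assms by auto
  have "(1 - u) * (1 - blinfun_apply a x) + u * (1 - blinfun_apply b x) = 0"
  proof -
    have "blinfun_apply f x = 1"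
      using f(1) by (simp add: norming_set_def)
    then show ?thesis
      unfolding u(3) by (simp add: blinfun.add_left blinfun.diff_left blinfun.scaleR_left algebra_simps)
  qed
  then have "(1 - u) * (1 - blinfun_apply a x) = 0 \<and> u * (1 - blinfun_apply b x) = 0"
    using le u by (intro iffD1[OF add_nonneg_eq_0_iff]) auto
  then have "blinfun_apply a x = 1" "blinfun_apply b x = 1"
    using u by auto
  then show "a \<in> norming_set x" "b \<in> norming_set x"
    using ab by (auto simp: norming_set_eq[OF assms])
qed

text \<open>If a face contains a point \<open>f\<close> of norm below 1, every \<open>g\<close> in
  the ball is an endpoint of a segment in the ball with \<open>f\<close> in its interior, so the
  face is the whole ball.\<close>

lemma proper_face_of_ball_subset_sphere:
  fixes F :: "'b::real_normed_vector set"
  assumes F: "F face_of cball 0 1" "F \<noteq> cball 0 1"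
  shows "F \<subseteq> sphere 0 1"
proof
  fix f
  assume f: "f \<in> F"
  show "f \<in> sphere 0 1"
  proof (rule ccontr)
    assume "f \<notin> sphere 0 1"
    then have nf: "norm f < 1"
      using f F face_of_imp_subset by fastforce
    have "g \<in> F" if g: "g \<in> cball 0 1" for g
    proof (cases "g = f")
      case False
      \<comment> \<open>The segment from \<open>g\<close> through \<open>f\<close> is prolonged by
        exactly \<open>1 - norm f\<close>, so its endpoint \<open>h\<close> stays in the ball; then
        \<open>f\<close> divides it with weight \<open>1 / (1 + d)\<close> at
        \<open>h\<close>.\<close>
      define d where "d = (1 - norm f) / norm (f - g)"
      have d: "d > 0" "norm (d *\<^sub>R (f - g)) = 1 - norm f"
        using nf False by (simp_all add: d_def)
      define h where "h = f + d *\<^sub>R (f - g)"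
      have "norm h \<le> 1"
        using norm_triangle_ineq[of f "d *\<^sub>R (f - g)"] d(2) by (simp add: h_def)
      moreover have "h \<noteq> g"
      proof
        assume "h = g"
        then have "(1 + d) *\<^sub>R (f - g) = 0"
          by (simp add: h_def algebra_simps)
        with False d(1) show False by simp
      qed
      moreover have "f = (1 - 1 / (1 + d)) *\<^sub>R g + (1 / (1 + d)) *\<^sub>R h"
      proof -
        have "(1 + d) *\<^sub>R ((1 - 1 / (1 + d)) *\<^sub>R g + (1 / (1 + d)) *\<^sub>R h) = d *\<^sub>R g + h"
          using d(1) by (simp add: scaleR_add_right right_diff_distrib)
        also have "\<dots> = (1 + d) *\<^sub>R f"
          by (simp add: h_def algebra_simps)
        finally show ?thesis
          using d(1) by simp
      qed
      ultimately have "f \<in> open_segment g h"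
        unfolding in_segment using d(1) by (intro conjI exI[of _ "1 / (1 + d)"]) auto
      then show ?thesis
        using face_ofD[OF F(1) _ g _ f] \<open>norm h \<le> 1\<close> by auto
    qed (use f in simp)
    then show False
      using F face_of_imp_subset by blast
  qed
qed

section \<open>Functionals on \<open>C(K)\<close>\<close>

lemma CK_add: "f \<in> CK K \<Longrightarrow> g \<in> CK K \<Longrightarrow> (\<lambda>t. f t + g t) \<in> CK K"
  by (auto simp: CK_def intro: continuous_map_add)

lemma CK_scale: "f \<in> CK K \<Longrightarrow> (\<lambda>t. c * f t) \<in> CK K"
  by (auto simp: CK_def intro: continuous_map_real_mult_left)

lemma CK_diff: "f \<in> CK K \<Longrightarrow> g \<in> CK K \<Longrightarrow> (\<lambda>t. f t - g t) \<in> CK K"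
  by (auto simp: CK_def intro: continuous_map_diff)

lemma CK_sum: "finite I \<Longrightarrow> (\<And>i. i \<in> I \<Longrightarrow> f i \<in> CK K) \<Longrightarrow> (\<lambda>t. \<Sum>i\<in>I. f i t) \<in> CK K"
  by (auto simp: CK_def intro: continuous_map_sum)

lemma CK_clamp: "r \<ge> 0 \<Longrightarrow> f \<in> CK K \<Longrightarrow> (\<lambda>t. max (- r) (min r (f t))) \<in> CK K"
  by (auto simp: CK_def intro!: continuous_map_real_max continuous_map_real_min)

lemma CK_restrict:
  assumes "continuous_map K euclideanreal f"
  shows "(\<lambda>t. if t \<in> topspace K then f t else 0) \<in> CK K"
  using continuous_map_eq[OF assms, of "\<lambda>t. if t \<in> topspace K then f t else 0"]
  by (auto simp: CK_def)

lemma bdd_above_CK: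
  assumes "compact_space K" "f \<in> CK K"
  shows "bdd_above (insert 0 ((\<lambda>t. \<bar>f t\<bar>) ` topspace K))"
proof -
  have "compactin euclideanreal (f ` topspace K)"
    using assms by (intro image_compactin[of K]) (auto simp: CK_def compact_space_def)
  then have "bounded (f ` topspace K)"
    by (simp add: compact_imp_bounded)
  then show ?thesis
    unfolding bdd_above_insert bounded_iff by (auto intro: bdd_aboveI2)
qed

lemma abs_le_supnorm:
  assumes "compact_space K" "f \<in> CK K"
  shows "\<bar>f t\<bar> \<le> supnorm K f"
proof (cases "t \<in> topspace K")
  case True
  then show ?thesis
    unfolding supnorm_def by (intro cSup_upper bdd_above_CK assms) auto
next
  case False
  then have "f t = 0"
    using assms by (simp add: CK_def)
  moreover have "0 \<le> supnorm K f"
    unfolding supnorm_def by (intro cSup_upper bdd_above_CK assms) auto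
  ultimately show ?thesis
    by simp
qed

lemma supnorm_nonneg: "compact_space K \<Longrightarrow> f \<in> CK K \<Longrightarrow> 0 \<le> supnorm K f"
  using abs_le_supnorm[of K f undefined] by linarith

lemma supnorm_le:
  assumes "0 \<le> r" "\<And>t. t \<in> topspace K \<Longrightarrow> \<bar>f t\<bar> \<le> r"
  shows "supnorm K f \<le> r"
  unfolding supnorm_def using assms by (intro cSup_least) auto

text \<open>A nonzero sup norm excludes the empty carrier, for which \<open>supnorm\<close> is the
  inserted value \<open>0\<close>; the rest is compactness.\<close>

lemma supnorm_attained:
  assumes "compact_space K" "f \<in> CK K" "supnorm K f \<noteq> 0"
  obtains t where "t \<in> topspace K" "\<bar>f t\<bar> = supnorm K f"
proof -
  let ?A = "(\<lambda>t. \<bar>f t\<bar>) ` topspace K"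
  have ne: "topspace K \<noteq> {}"
    using assms(3) by (auto simp: supnorm_def)
  have "compactin euclideanreal ?A"
    using assms by (intro image_compactin[of K] continuous_map_real_abs)
      (auto simp: CK_def compact_space_def)
  then obtain t where t: "t \<in> topspace K" "\<And>s. s \<in> topspace K \<Longrightarrow> \<bar>f s\<bar> \<le> \<bar>f t\<bar>"
    using compact_attains_sup[of ?A] ne by auto
  then have "supnorm K f \<le> \<bar>f t\<bar>"
    by (intro supnorm_le) auto
  with t(1) show ?thesis
    using that abs_le_supnorm[OF assms(1,2), of t] by force
qed

text \<open>Urysohn's lemma for \<open>{t}\<close> and the finite closed set \<open>I - {t}\<close>.
  Testing with such a function isolates one coefficient of a finite sum of point
  evaluations.\<close>

lemma CK_peak:
  assumes K: "compact_space K" "Hausdorff_space K"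
    and I: "finite I" "I \<subseteq> topspace K" and t: "t \<in> topspace K"
  obtains f where "f \<in> CK K" "f t = 1" "\<And>s. s \<in> I \<Longrightarrow> s \<noteq> t \<Longrightarrow> f s = 0"
proof -
  have "normal_space K"
    using K compact_Hausdorff_or_regular_imp_normal_space by blast
  moreover have "closedin K {t}" "closedin K (I - {t})"
    using K I t by (auto intro: closedin_Hausdorff_finite)
  ultimately obtain g :: "_ \<Rightarrow> real" where g: "continuous_map K euclideanreal g"
    "g ` {t} \<subseteq> {1}" "g ` (I - {t}) \<subseteq> {0}"
    using Urysohn_lemma_alt[of K "{t}" "I - {t}"] by (auto simp: disjnt_def)
  then show ?thesis
    using CK_restrict[OF g(1)] t I
    by (intro that[of "\<lambda>t. if t \<in> topspace K then g t else 0"]) (auto simp: image_subset_iff)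
qed

section \<open>Bounded functionals on \<open>CK K\<close> and their norms\<close>

lemma CK_dual_add:
  "\<phi> \<in> CK_dual K \<Longrightarrow> f \<in> CK K \<Longrightarrow> g \<in> CK K \<Longrightarrow> \<phi> (\<lambda>t. f t + g t) = \<phi> f + \<phi> g"
  by (simp add: CK_dual_def)

lemma CK_dual_scale: "\<phi> \<in> CK_dual K \<Longrightarrow> f \<in> CK K \<Longrightarrow> \<phi> (\<lambda>t. c * f t) = c * \<phi> f"
  by (simp add: CK_dual_def)

lemma CK_dual_diff:
  assumes "\<phi> \<in> CK_dual K" "f \<in> CK K" "g \<in> CK K"
  shows "\<phi> (\<lambda>t. f t - g t) = \<phi> f - \<phi> g"
  using CK_dual_add[OF assms(1,2) CK_scale[OF assms(3), of "-1"]] CK_dual_scale[OF assms(1,3), of "-1"]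
  by simp

lemma CK_dual_sum:
  assumes "\<phi> \<in> CK_dual K" "finite I" "\<And>i. i \<in> I \<Longrightarrow> f i \<in> CK K"
  shows "\<phi> (\<lambda>t. \<Sum>i\<in>I. f i t) = (\<Sum>i\<in>I. \<phi> (f i))"
  using assms(2,3)
proof (induction I rule: finite_induct)
  case empty
  have "(\<lambda>t. 0) \<in> CK K"
    by (simp add: CK_def)
  from CK_dual_scale[OF assms(1) this, of 0] show ?case
    by simp
next
  case (insert i I)
  then show ?case
    using CK_dual_add[OF assms(1), of "f i" "\<lambda>t. \<Sum>i\<in>I. f i t"] by (simp add: CK_sum)
qed

lemma bdd_above_CK_dual:
  assumes "compact_space K" "\<phi> \<in> CK_dual K"
  shows "bdd_above (insert 0 {\<bar>\<phi> f\<bar> | f. f \<in> CK K \<and> supnorm K f \<le> 1})"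
proof -
  obtain M where M: "\<forall>f\<in>CK K. \<bar>\<phi> f\<bar> \<le> M * supnorm K f"
    using assms by (auto simp: CK_dual_def)
  have "\<bar>\<phi> f\<bar> \<le> \<bar>M\<bar>" if f: "f \<in> CK K" "supnorm K f \<le> 1" for f
  proof -
    have "\<bar>\<phi> f\<bar> \<le> M * supnorm K f"
      using M f by blast
    also have "\<dots> \<le> \<bar>M\<bar> * 1"
      using supnorm_nonneg[OF assms(1)] f by (intro mult_mono) auto
    finally show ?thesis
      by simp
  qed
  then show ?thesis
    by (auto simp: bdd_above_def intro!: exI[of _ "\<bar>M\<bar>"])
qed

lemma CK_dual_norm_nonneg: "compact_space K \<Longrightarrow> \<phi> \<in> CK_dual K \<Longrightarrow> 0 \<le> CK_dual_norm K \<phi>"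
  unfolding CK_dual_norm_def by (intro cSup_upper bdd_above_CK_dual) auto

lemma CK_dual_bound:
  assumes "compact_space K" "\<phi> \<in> CK_dual K" "f \<in> CK K"
  shows "\<bar>\<phi> f\<bar> \<le> CK_dual_norm K \<phi> * supnorm K f"
proof (cases "supnorm K f = 0")
  case True
  \<comment> \<open>Rescaling \<open>f\<close> is impossible here; any bound \<open>M\<close>
    already gives \<open>\<phi> f = 0\<close>.\<close>
  obtain M where "\<forall>f\<in>CK K. \<bar>\<phi> f\<bar> \<le> M * supnorm K f"
    using assms by (auto simp: CK_dual_def)
  then show ?thesis
    using True assms(3) by fastforce
next
  case False
  define s where "s = supnorm K f"
  have s: "s > 0"
    using False supnorm_nonneg[OF assms(1,3)] by (simp add: s_def)
  have "supnorm K (\<lambda>t. (1 / s) * f t) \<le> 1"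
    using s abs_le_supnorm[OF assms(1,3)] by (intro supnorm_le) (simp_all add: abs_mult s_def)
  then have "\<bar>\<phi> (\<lambda>t. (1 / s) * f t)\<bar> \<le> CK_dual_norm K \<phi>"
    unfolding CK_dual_norm_def
    by (intro cSup_upper bdd_above_CK_dual assms(1,2)) (use CK_scale[OF assms(3)] in blast)
  then show ?thesis
    using s by (simp only: CK_dual_scale[OF assms(2,3)]) (simp add: abs_mult s_def field_simps)
qed

lemma CK_dual_bound_one:
  assumes "compact_space K" "\<phi> \<in> CK_dual K" "f \<in> CK K" "\<And>t. t \<in> topspace K \<Longrightarrow> \<bar>f t\<bar> \<le> 1"
  shows "\<phi> f \<le> CK_dual_norm K \<phi>"
proof -
  have "\<bar>\<phi> f\<bar> \<le> CK_dual_norm K \<phi> * supnorm K f"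
    using assms by (intro CK_dual_bound)
  also have "\<dots> \<le> CK_dual_norm K \<phi> * 1"
    using assms CK_dual_norm_nonneg by (intro mult_left_mono supnorm_le) auto
  finally show ?thesis
    by simp
qed

lemma CK_dual_norm_le:
  assumes "0 \<le> r" "\<And>f. f \<in> CK K \<Longrightarrow> \<bar>\<phi> f\<bar> \<le> r * supnorm K f"
  shows "CK_dual_norm K \<phi> \<le> r"
  unfolding CK_dual_norm_def
proof (rule cSup_least)
  fix y
  assume "y \<in> insert 0 {\<bar>\<phi> f\<bar> |f. f \<in> CK K \<and> supnorm K f \<le> 1}"
  then consider "y = 0" | f where "y = \<bar>\<phi> f\<bar>" "f \<in> CK K" "supnorm K f \<le> 1"
    by blast
  then show "y \<le> r"
  proof cases
    case 2
    then show ?thesis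
      using assms(2)[of f] mult_left_mono[OF 2(3) assms(1)] by linarith
  qed (use assms in simp)
qed simp

section \<open>Finitely supported and norm-attaining functionals\<close>

lemma atomic_functional_bound:
  assumes "compact_space K" "f \<in> CK K"
  shows "\<bar>\<Sum>i\<in>A. a i * f (p i)\<bar> \<le> (\<Sum>i\<in>A. \<bar>a i\<bar>) * supnorm K f"
proof -
  have "\<bar>\<Sum>i\<in>A. a i * f (p i)\<bar> \<le> (\<Sum>i\<in>A. \<bar>a i * f (p i)\<bar>)"
    by (rule sum_abs)
  also have "\<dots> \<le> (\<Sum>i\<in>A. \<bar>a i\<bar> * supnorm K f)"
    by (intro sum_mono) (simp add: abs_mult mult_left_mono abs_le_supnorm assms)
  finally show ?thesis
    by (simp add: sum_distrib_right)
qed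

lemma atomic_functional_in_CK_dual:
  assumes "compact_space K"
  shows "(\<lambda>f. \<Sum>i\<in>A. a i * f (p i)) \<in> CK_dual K"
proof -
  have "\<exists>M. \<forall>f\<in>CK K. \<bar>\<Sum>i\<in>A. a i * f (p i)\<bar> \<le> M * supnorm K f"
    using atomic_functional_bound[OF assms] by blast
  then show ?thesis
    by (simp add: CK_dual_def distrib_left sum.distrib sum_distrib_left mult.left_commute)
qed

text \<open>
  A replacement for the Riesz representation theorem: if \<open>f\<close> vanishes near the set where
  \<open>\<bar>g\<bar> = 1\<close>, then \<open>g \<plusminus> s f\<close> stays in the unit ball for small \<open>s\<close>,
  and \<open>\<phi>\<close> attains its norm at \<open>g\<close>.
\<close>

lemma norm_attaining_functional_vanishes:
  assumes K: "compact_space K" and \<phi>: "\<phi> \<in> CK_dual K"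
    and g: "g \<in> CK K" "\<And>t. t \<in> topspace K \<Longrightarrow> \<bar>g t\<bar> \<le> 1" "\<phi> g = CK_dual_norm K \<phi>"
    and f: "f \<in> CK K" "\<And>t. t \<in> topspace K \<Longrightarrow> \<bar>g t\<bar> = 1 \<Longrightarrow> f t = 0"
  shows "\<phi> f = 0"
proof -
  define N where "N = CK_dual_norm K \<phi>"
  have N: "N \<ge> 0"
    using K \<phi> CK_dual_norm_nonneg by (auto simp: N_def)
  have main: "\<bar>\<phi> f\<bar> \<le> N * \<epsilon>" if \<epsilon>: "\<epsilon> > 0" for \<epsilon>
  proof -
    \<comment> \<open>\<open>f\<close> vanishes where \<open>\<bar>g\<bar> = 1\<close> but perhaps
      not nearby. Removing the truncation \<open>h\<close>, of sup norm at most
      \<open>\<epsilon>\<close>, leaves \<open>p\<close>, which is zero outside the set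
      \<open>S\<close> below.\<close>
    define h where "h = (\<lambda>t. max (- \<epsilon>) (min \<epsilon> (f t)))"
    define p where "p = (\<lambda>t. f t - h t)"
    have h: "h \<in> CK K"
      unfolding h_def using \<epsilon> f(1) by (intro CK_clamp) auto
    have p: "p \<in> CK K"
      unfolding p_def by (intro CK_diff f h)
    define S where "S = {t \<in> topspace K. \<bar>f t\<bar> \<in> {\<epsilon>..}}"
    have "closedin K S"
      unfolding S_def using f(1)
      by (intro closedin_continuous_map_preimage[where Y = euclideanreal] continuous_map_real_abs)
        (auto simp: CK_def)
    then have "compactin K S"
      using K closedin_compact_space by blast
    then have "compactin euclideanreal ((\<lambda>t. \<bar>g t\<bar>) ` S)"
      using g(1) by (intro image_compactin[of K] continuous_map_real_abs) (auto simp: CK_def)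
    then have cpt: "compact ((\<lambda>t. \<bar>g t\<bar>) ` S)"
      by simp
    have lt: "\<bar>g t\<bar> < 1" if "t \<in> S" for t
      using that f(2)[of t] g(2)[of t] \<epsilon> by (force simp: S_def)
    obtain \<eta> where \<eta>: "\<eta> > 0" "\<And>t. t \<in> S \<Longrightarrow> \<bar>g t\<bar> \<le> 1 - \<eta>"
    proof (cases "S = {}")
      case True
      then show ?thesis
        using that[of 1] by simp
    next
      case False
      then obtain t where t: "t \<in> S" "\<And>s. s \<in> S \<Longrightarrow> \<bar>g s\<bar> \<le> \<bar>g t\<bar>"
        using compact_attains_sup[OF cpt] by auto
      show ?thesis
        using that[of "1 - \<bar>g t\<bar>"] lt t by simp
    qed
    define M where "M = supnorm K p"
    have M: "M \<ge> 0" "\<And>t. \<bar>p t\<bar> \<le> M"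
      using K p supnorm_nonneg abs_le_supnorm by (auto simp: M_def)
    \<comment> \<open>On \<open>S\<close> there is room \<open>\<eta>\<close> below 1, and
      \<open>s\<close> is small enough that \<open>s * \<bar>p t\<bar>\<close> fits into it; the
      \<open>+ 1\<close> guards against \<open>M = 0\<close>.\<close>
    define s where "s = \<eta> / (M + 1)"
    have s: "s > 0" "s * M \<le> \<eta>"
      using \<eta>(1) M(1) by (auto simp: s_def field_simps)
    have perturb: "\<sigma> * (s * \<phi> p) \<le> 0" if \<sigma>: "\<bar>\<sigma>\<bar> = 1" for \<sigma> :: real
    proof -
      have "\<bar>g t + (\<sigma> * s) * p t\<bar> \<le> 1" if t: "t \<in> topspace K" for t
      proof (cases "t \<in> S")
        case True
        have "\<bar>(\<sigma> * s) * p t\<bar> = s * \<bar>p t\<bar>"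
          using \<sigma> s(1) by (simp add: abs_mult)
        also have "\<dots> \<le> s * M"
          using s(1) M(2) by (intro mult_left_mono) auto
        finally show ?thesis
          using \<eta>(2)[OF True] s(2) by linarith
      next
        case False
        then have "p t = 0"
          using t by (auto simp: S_def p_def h_def)
        then show ?thesis
          using g(2)[OF t] by simp
      qed
      then have "\<phi> (\<lambda>t. g t + (\<sigma> * s) * p t) \<le> CK_dual_norm K \<phi>"
        by (intro CK_dual_bound_one K \<phi> CK_add CK_scale g(1) p)
      then show ?thesis
        using g(3) CK_dual_add[OF \<phi> g(1) CK_scale[OF p]] CK_dual_scale[OF \<phi> p] by simp
    qed
    from perturb[of 1] perturb[of "- 1"] have "\<phi> p = 0"
      using s(1) by simp
    moreover have "\<phi> p = \<phi> f - \<phi> h"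
      unfolding p_def using \<phi> f(1) h by (rule CK_dual_diff)
    moreover have "\<bar>\<phi> h\<bar> \<le> N * supnorm K h"
      unfolding N_def using K \<phi> h by (rule CK_dual_bound)
    moreover have "N * supnorm K h \<le> N * \<epsilon>"
      using N \<epsilon> by (intro mult_left_mono supnorm_le) (auto simp: h_def)
    ultimately show ?thesis
      by linarith
  qed
  have "\<bar>\<phi> f\<bar> \<le> 0 + e" if "e > 0" for e
  proof -
    have "\<bar>\<phi> f\<bar> \<le> N * (e / (N + 1))"
      using N that by (intro main) simp
    also have "\<dots> \<le> e"
      using N that by (simp add: field_simps)
    finally show ?thesis
      by simp
  qed
  then have "\<bar>\<phi> f\<bar> \<le> 0"
    by (rule field_le_epsilon)
  then show ?thesis
    by simp
qed

text \<open>Interpolating \<open>f\<close> on the finite set \<open>Z\<close> by peak functions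
  leaves a remainder that vanishes on \<open>Z\<close>, and \<open>\<phi>\<close> annihilates
  it.\<close>

lemma norm_attaining_functional_atomic:
  assumes K: "compact_space K" "Hausdorff_space K" and \<phi>: "\<phi> \<in> CK_dual K"
    and g: "g \<in> CK K" "\<And>t. t \<in> topspace K \<Longrightarrow> \<bar>g t\<bar> \<le> 1" "\<phi> g = CK_dual_norm K \<phi>"
    and Z: "Z = {t \<in> topspace K. \<bar>g t\<bar> = 1}" "finite Z"
  obtains c where "\<And>f. f \<in> CK K \<Longrightarrow> \<phi> f = (\<Sum>z\<in>Z. c z * (g z * f z))"
proof -
  have "\<exists>u. u \<in> CK K \<and> u z = 1 \<and> (\<forall>s\<in>Z. s \<noteq> z \<longrightarrow> u s = 0)" if "z \<in> Z" for z
    using CK_peak[OF K Z(2), of z] that Z(1) by (metis (no_types, lifting) mem_Collect_eq subsetI)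
  then obtain u where u: "\<And>z. z \<in> Z \<Longrightarrow> u z \<in> CK K" "\<And>z. z \<in> Z \<Longrightarrow> u z z = 1"
    "\<And>z s. z \<in> Z \<Longrightarrow> s \<in> Z \<Longrightarrow> s \<noteq> z \<Longrightarrow> u z s = 0"
    by metis
  define b where "b z = \<phi> (u z)" for z
  have sum_u: "(\<Sum>z\<in>Z. a z * u z s) = a s" if "s \<in> Z" for a s
  proof -
    have "(\<Sum>z\<in>Z. a z * u z s) = (\<Sum>z\<in>Z. if z = s then a z else 0)"
      using u that by (intro sum.cong) auto
    then show ?thesis
      using that Z(2) by simp
  qed
  have rep: "\<phi> f = (\<Sum>z\<in>Z. b z * f z)" if f: "f \<in> CK K" for f
  proof -
    define q where "q = (\<lambda>t. \<Sum>z\<in>Z. f z * u z t)"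
    have q: "q \<in> CK K"
      unfolding q_def using u Z(2) by (intro CK_sum CK_scale) auto
    have "\<phi> (\<lambda>t. f t - q t) = 0"
      using sum_u Z(1)
      by (intro norm_attaining_functional_vanishes[OF K(1) \<phi> g] CK_diff f q) (auto simp: q_def)
    moreover have "\<phi> q = (\<Sum>z\<in>Z. f z * b z)"
      unfolding q_def using u Z(2)
      by (subst CK_dual_sum[OF \<phi>]) (auto intro!: CK_scale sum.cong simp: CK_dual_scale[OF \<phi>] b_def)
    ultimately show ?thesis
      using CK_dual_diff[OF \<phi> f q] by (simp add: mult.commute)
  qed
  \<comment> \<open>On \<open>Z\<close> the square of \<open>g z\<close> is 1, so the sign
    \<open>g z\<close> can be moved into the coefficient. This form pairs the coefficients with the
    signed points used in \<open>extension_unique\<close>.\<close>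
  have "b z = b z * g z * g z" if "z \<in> Z" for z
    using that Z(1) abs_mult_self_eq[of "g z"] by (simp add: mult.assoc)
  then have "\<phi> f = (\<Sum>z\<in>Z. (b z * g z) * (g z * f z))" if "f \<in> CK K" for f
    unfolding rep[OF that] by (intro sum.cong refl) (metis mult.assoc)
  then show ?thesis
    by (rule that)
qed

section \<open>Norm-preserving extensions\<close>

text \<open>Since \<open>T\<close> preserves norms, an extension can never have smaller norm than
  \<open>x'\<close>; only the upper estimate has to be supplied.\<close>

lemma CK_dual_norm_extension:
  assumes K: "compact_space K" and T: "\<And>x. T x \<in> CK K" "\<And>x. supnorm K (T x) = norm x"
    and \<phi>: "\<phi> \<in> CK_dual K" "\<And>x. \<phi> (T x) = blinfun_apply x' x"
    and bound: "\<And>f. f \<in> CK K \<Longrightarrow> \<bar>\<phi> f\<bar> \<le> norm x' * supnorm K f"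
  shows "CK_dual_norm K \<phi> = norm x'"
proof (rule antisym)
  show "CK_dual_norm K \<phi> \<le> norm x'"
    using bound by (intro CK_dual_norm_le) auto
  show "norm x' \<le> CK_dual_norm K \<phi>"
  proof (rule norm_blinfun_bound)
    show "norm (blinfun_apply x' x) \<le> CK_dual_norm K \<phi> * norm x" for x
      using CK_dual_bound[OF K \<phi>(1) T(1), of x] \<phi>(2) T(2) by simp
  qed (use CK_dual_norm_nonneg K \<phi> in blast)
qed

lemma extreme_point_of_ball_minus:
  assumes "e extreme_point_of cball (0::'b::real_normed_vector) 1"
  shows "- e extreme_point_of cball 0 1"
proof -
  have "e \<in> open_segment (- a) (- b)" if "- e \<in> open_segment a b" for a b
  proof -
    have "uminus ` open_segment a b = open_segment (- a) (- b)"
      using open_segment_linear_image[OF linear_uminus inj_uminus] by metis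
    then show ?thesis
      using that by (metis add.inverse_inverse imageI)
  qed
  then show ?thesis
    using assms unfolding extreme_point_of_def by (metis mem_cball_0 norm_minus_cancel)
qed

lemma uminus_closure_ext_pts_ball:
  "uminus ` closure (ext_pts (cball (0::'b::real_normed_vector) 1)) = closure (ext_pts (cball 0 1))"
proof -
  have "uminus ` ext_pts (cball (0::'b) 1) = ext_pts (cball 0 1)"
  proof (intro set_eqI iffI)
    fix e :: 'b
    assume "e \<in> ext_pts (cball 0 1)"
    then have "- e \<in> ext_pts (cball 0 1)"
      by (simp add: ext_pts_def extreme_point_of_ball_minus)
    then show "e \<in> uminus ` ext_pts (cball 0 1)"
      by force
  qed (auto simp: ext_pts_def extreme_point_of_ball_minus)
  then show ?thesis
    using closure_scaleR[of "- 1" "ext_pts (cball (0::'b) 1)"] by simp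
qed

section \<open>Necessity\<close>

text \<open>The zero space is treated apart: there \<open>K\<close> may be empty, and then no point
  of \<open>K\<close> represents the extreme point \<open>0\<close> of the dual ball.\<close>

locale U_embedded =
  fixes K :: "'k topology" and T :: "'a::real_normed_vector \<Rightarrow> 'k \<Rightarrow> real"
  assumes findim: "\<exists>B. finite B \<and> span B = (UNIV :: 'a set)"
    and compact_K: "compact_space K" and Hausdorff_K: "Hausdorff_space K"
    and U: "U_embedding_CK K T" and nontrivial: "\<exists>x::'a. x \<noteq> 0"
begin

lemma T_in_CK: "T x \<in> CK K" and T_add: "T (x + y) t = T x t + T y t"
  and T_scale: "T (c *\<^sub>R x) t = c * T x t" and supnorm_T: "supnorm K (T x) = norm x"
  using U unfolding U_embedding_CK_def by simp_all

text \<open>This is the adjoint of \<open>T\<close> applied to the point mass at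
  \<open>t\<close>.\<close>

definition ev :: "'k \<Rightarrow> ('a \<Rightarrow>\<^sub>L real)" where
  "ev t = Blinfun (\<lambda>x. T x t)"

lemma ev_apply [simp]: "blinfun_apply (ev t) x = T x t"
proof -
  have "bounded_linear (\<lambda>x. T x t)"
    using T_add T_scale abs_le_supnorm[OF compact_K T_in_CK] supnorm_T
    by (intro bounded_linear_intro[where K = 1]) auto
  then show ?thesis
    by (simp add: ev_def bounded_linear_Blinfun_apply)
qed

lemma norm_ev_le: "norm (ev t) \<le> 1"
  using abs_le_supnorm[OF compact_K T_in_CK] supnorm_T by (intro norm_blinfun_bound) auto

text \<open>Expanding \<open>ev t\<close> in a finite basis gives coefficients
  \<open>T (combination b) t\<close>, each continuous in \<open>t\<close>, so \<open>ev\<close> is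
  continuous on the compact space \<open>K\<close>.\<close>

lemma compact_range_ev: "compact (ev ` topspace K)"
proof -
  obtain G where "euclidean_embedding (dual_coordinates :: ('a \<Rightarrow>\<^sub>L real) \<Rightarrow> _) G"
    using ex_dual_embedding[OF findim] by metis
  then interpret euclidean_embedding "dual_coordinates :: ('a \<Rightarrow>\<^sub>L real) \<Rightarrow> _" G .
  have linG: "linear G"
    using bounded_linear_G by (rule bounded_linear.linear)
  have eq: "ev t = (\<Sum>b\<in>Basis. T (combination b) t *\<^sub>R G b)" for t
  proof -
    have "ev t = G (\<Sum>b\<in>Basis. (dual_coordinates (ev t) \<bullet> b) *\<^sub>R b)"
      by (simp add: euclidean_representation)
    also have "\<dots> = (\<Sum>b\<in>Basis. (b \<bullet> dual_coordinates (ev t)) *\<^sub>R G b)"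
      by (simp add: linear_sum[OF linG] linear_scale[OF linG] inner_commute)
    finally show ?thesis
      by (simp add: inner_dual_coordinates)
  qed
  have "continuous_map K euclidean (\<lambda>t. \<Sum>b\<in>Basis. T (combination b) t *\<^sub>R G b)"
  proof (rule continuous_map_sum)
    fix b :: "real ^ 'a spanning_index"
    have 1: "continuous_map K euclideanreal (T (combination b))"
      using T_in_CK by (simp add: CK_def)
    have 2: "continuous_map euclideanreal euclidean (\<lambda>r. r *\<^sub>R G b)"
      unfolding continuous_map_iff_continuous2 by (intro continuous_intros)
    show "continuous_map K euclidean (\<lambda>t. T (combination b) t *\<^sub>R G b)"
      using continuous_map_compose[OF 1 2] by (simp add: o_def)
  qed simp
  then have "continuous_map K euclidean ev"
    using eq by presburger
  then have "compactin euclidean (ev ` topspace K)"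
    using compact_K by (intro image_compactin[of K]) (auto simp: compact_space_def)
  then show ?thesis
    by simp
qed

text \<open>Were \<open>f\<close> in the ball but outside the hull of the evaluations and their
  negatives, a separating vector \<open>x\<close> would have
  \<open>\<bar>T x t\<bar> < norm x\<close> on all of \<open>K\<close>, although the sup norm is
  attained. So the hull is the ball, and extreme points of a hull lie in the generating set.\<close>

lemma ext_pts_subset: "ext_pts (cball (0 :: 'a \<Rightarrow>\<^sub>L real) 1) \<subseteq> ev ` topspace K \<union> uminus ` ev ` topspace K"
proof -
  let ?S = "ev ` topspace K \<union> uminus ` ev ` topspace K"
  have "compact ?S"
    using compact_range_ev by (simp add: compact_Un compact_negations)
  have attained: "\<exists>t\<in>topspace K. \<bar>T x t\<bar> = norm x" if "x \<noteq> 0" for x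
    using supnorm_attained[OF compact_K T_in_CK, of x] supnorm_T that by (metis norm_eq_zero)
  have "cball (0 :: 'a \<Rightarrow>\<^sub>L real) 1 \<subseteq> convex hull ?S"
  proof (rule ccontr)
    assume "\<not> ?thesis"
    then obtain f where f: "norm f \<le> 1" "f \<notin> convex hull ?S"
      using mem_cball_0 by blast
    obtain x b where x: "\<And>g. g \<in> ?S \<Longrightarrow> blinfun_apply g x < b" "b < blinfun_apply f x"
      using separate_point_dual[OF findim \<open>compact ?S\<close> f(2)] by metis
    have "topspace K \<noteq> {}"
      using attained nontrivial by blast
    then have "x \<noteq> 0"
      using x by fastforce
    then obtain t where t: "t \<in> topspace K" "\<bar>T x t\<bar> = norm x"
      using attained by blast
    have "norm x < b"
      using x(1)[of "ev t"] x(1)[of "- ev t"] t by (auto simp: blinfun.minus_left)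
    moreover have "blinfun_apply f x \<le> norm x"
      using norm_blinfun[of f x] mult_right_mono[OF f(1) norm_ge_zero[of x]] by simp
    ultimately show False
      using x(2) by linarith
  qed
  moreover have "convex hull ?S \<subseteq> cball 0 1"
    using norm_ev_le by (intro hull_minimal convex_cball) auto
  ultimately have "convex hull ?S = cball 0 1"
    by blast
  then show ?thesis
    using extreme_point_of_convex_hull[of _ ?S] by (auto simp: ext_pts_def)
qed

text \<open>With \<open>sg\<close> below, this selects a signed point mass for each extreme point,
  so that combinations of extreme points become combinations of evaluations with the same total
  mass.\<close>

definition pt :: "('a \<Rightarrow>\<^sub>L real) \<Rightarrow> 'k" where
  "pt w = (SOME t. t \<in> topspace K \<and> (w = ev t \<or> w = - ev t))"

definition sg :: "('a \<Rightarrow>\<^sub>L real) \<Rightarrow> real" where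
  "sg w = (if w = ev (pt w) then 1 else - 1)"

lemma pt_sg:
  assumes "w \<in> ext_pts (cball 0 1)"
  shows pt_in: "pt w \<in> topspace K" and sg_ev: "sg w *\<^sub>R ev (pt w) = w"
proof -
  have "\<exists>t. t \<in> topspace K \<and> (w = ev t \<or> w = - ev t)"
    using ext_pts_subset assms by blast
  then have "pt w \<in> topspace K \<and> (w = ev (pt w) \<or> w = - ev (pt w))"
    unfolding pt_def by (rule someI_ex)
  then show "pt w \<in> topspace K" "sg w *\<^sub>R ev (pt w) = w"
    by (auto simp: sg_def)
qed

lemma abs_sg [simp]: "\<bar>sg w\<bar> = 1"
  by (simp add: sg_def)

lemma atomic_extension:
  assumes "(\<Sum>i\<in>A. a i *\<^sub>R ev (p i)) = x'" "(\<Sum>i\<in>A. \<bar>a i\<bar>) \<le> norm x'"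
  defines "\<phi> \<equiv> \<lambda>f. \<Sum>i\<in>A. a i * f (p i)"
  shows "\<phi> \<in> CK_dual K" "\<phi> (T x) = blinfun_apply x' x" "CK_dual_norm K \<phi> = norm x'"
proof -
  show dual: "\<phi> \<in> CK_dual K"
    unfolding \<phi>_def by (rule atomic_functional_in_CK_dual[OF compact_K])
  have ext: "\<phi> (T x) = blinfun_apply x' x" for x
    unfolding \<phi>_def assms(1)[symmetric] by (simp add: blinfun.sum_left blinfun.scaleR_left)
  then show "\<phi> (T x) = blinfun_apply x' x" .
  have bound: "\<bar>\<phi> h\<bar> \<le> norm x' * supnorm K h" if "h \<in> CK K" for h
    using atomic_functional_bound[OF compact_K that, of a p A]
      mult_right_mono[OF assms(2) supnorm_nonneg[OF compact_K that]] unfolding \<phi>_def by linarith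
  show "CK_dual_norm K \<phi> = norm x'"
    using CK_dual_norm_extension[where T = T, OF compact_K T_in_CK supnorm_T dual ext bound] .
qed

text \<open>Both sums are norm-preserving extensions of \<open>x'\<close>, and the embedding admits
  only one. All of the necessity proof draws on uniqueness through this lemma.\<close>

lemma atomic_functionals_eq:
  assumes "(\<Sum>i\<in>A. a i *\<^sub>R ev (p i)) = x'" "(\<Sum>i\<in>A. \<bar>a i\<bar>) \<le> norm x'"
    and "(\<Sum>j\<in>B. b j *\<^sub>R ev (q j)) = x'" "(\<Sum>j\<in>B. \<bar>b j\<bar>) \<le> norm x'"
    and f: "f \<in> CK K"
  shows "(\<Sum>i\<in>A. a i * f (p i)) = (\<Sum>j\<in>B. b j * f (q j))"
proof -
  obtain y' where y': "\<And>z'. z' \<in> CK_dual K \<Longrightarrow> (\<forall>x. z' (T x) = blinfun_apply x' x) \<Longrightarrow>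
      CK_dual_norm K z' = norm x' \<Longrightarrow> z' f = y' f"
    using U f unfolding U_embedding_CK_def by metis
  have "(\<Sum>i\<in>A. a i * f (p i)) = y' f"
    by (rule y') (use atomic_extension[OF assms(1,2)] in blast)+
  moreover have "(\<Sum>j\<in>B. b j * f (q j)) = y' f"
    by (rule y') (use atomic_extension[OF assms(3,4)] in blast)+
  ultimately show ?thesis
    by simp
qed

text \<open>Otherwise the point mass at \<open>s\<close> and minus the point mass at
  \<open>t\<close> would both extend \<open>ev s\<close> with norm 1, but they differ on the
  constant function 1.\<close>

lemma ev_unit_not_minus:
  assumes "s \<in> topspace K" "t \<in> topspace K" "norm (ev s) = 1"
  shows "ev t \<noteq> - ev s"
proof
  assume eq: "ev t = - ev s"
  have "(\<lambda>t. if t \<in> topspace K then 1 else 0) \<in> CK K"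
    by (rule CK_restrict) simp
  then have "(\<Sum>i\<in>{()}. 1 * (if s \<in> topspace K then 1 else 0)) =
      (\<Sum>i\<in>{()}. - 1 * (if t \<in> topspace K then 1 else 0 :: real))"
    using assms(3) eq
    by (intro atomic_functionals_eq[where p = "\<lambda>_. s" and q = "\<lambda>_. t" and x' = "ev s"
          and f = "\<lambda>t. if t \<in> topspace K then 1 else 0" and a = "\<lambda>_. 1" and b = "\<lambda>_. - 1"])
      auto
  then show False
    using assms(1,2) by simp
qed

text \<open>
  Writing \<open>ev t\<close> as a convex combination of extreme points produces a second norm-one extension,
  which must be the point mass at \<open>t\<close>.
\<close>

lemma ev_unit_extreme:
  assumes t: "t \<in> topspace K" "norm (ev t) = 1"
  shows "ev t \<in> ext_pts (cball 0 1)"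
proof -
  obtain A c where A: "finite A" "A \<subseteq> ext_pts (cball (0 :: 'a \<Rightarrow>\<^sub>L real) 1)"
    "\<forall>w\<in>A. 0 \<le> c w" "sum c A = norm (ev t)" "(\<Sum>w\<in>A. c w *\<^sub>R w) = ev t"
    by (rule dual_ball_combination[OF findim, of "ev t"])
  have sub: "pt ` A \<subseteq> topspace K"
    using A(2) pt_in by blast
  obtain f where f: "f \<in> CK K" "f t = 1" "\<And>s. s \<in> pt ` A \<Longrightarrow> s \<noteq> t \<Longrightarrow> f s = 0"
    using CK_peak[OF compact_K Hausdorff_K finite_imageI[OF A(1)] sub t(1)] by blast
  have "(\<Sum>w\<in>A. (c w * sg w) *\<^sub>R ev (pt w)) = (\<Sum>w\<in>A. c w *\<^sub>R w)"
    using A(2) sg_ev by (intro sum.cong) (auto simp flip: scaleR_scaleR)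
  moreover have "(\<Sum>w\<in>A. \<bar>c w * sg w\<bar>) = norm (ev t)"
    using A(3) by (simp add: abs_mult flip: A(4))
  ultimately have "(\<Sum>w\<in>A. (c w * sg w) * f (pt w)) = (\<Sum>w\<in>{ev t}. 1 * f t)"
    using t A(5) f(1)
    by (intro atomic_functionals_eq[where x' = "ev t" and p = pt and q = "\<lambda>_. t"]) auto
  then have one: "(\<Sum>w\<in>A. (c w * sg w) * f (pt w)) = 1"
    using f(2) by simp
  \<comment> \<open>Some term of the sum must be positive; it belongs to an extreme point sitting at
    \<open>t\<close> with positive sign, which is \<open>ev t\<close> itself.\<close>
  have "\<exists>w\<in>A. pt w = t \<and> sg w = 1"
  proof (rule ccontr)
    assume neg: "\<not> ?thesis"
    have "(c w * sg w) * f (pt w) \<le> 0" if "w \<in> A" for w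
    proof (cases "pt w = t")
      case True
      then have "sg w = - 1"
        using neg that by (auto simp: sg_def split: if_splits)
      then show ?thesis
        using True bspec[OF A(3) that] f(2) by simp
    qed (use f(3) that in simp)
    then have "(\<Sum>w\<in>A. (c w * sg w) * f (pt w)) \<le> 0"
      by (rule sum_nonpos)
    with one show False by simp
  qed
  then show ?thesis
    using A(2) sg_ev by (metis scaleR_one subsetD)
qed

text \<open>Evaluations outside the closure of the extreme points are dropped, as condition (ii)
  requires.\<close>

definition E :: "('a \<Rightarrow>\<^sub>L real) set" where
  "E = ev ` topspace K \<inter> closure (ext_pts (cball 0 1))"

text \<open>Condition (i) is \<open>ev_unit_not_minus\<close>. Condition (ii) follows from
  \<open>ext_pts_subset\<close>, as the evaluations and their negatives form a closed set. For
  (iii), an element of \<open>E\<close> in a norming set has norm 1, so it is extreme in the ball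
  and hence in the face.\<close>

lemma proper_U_suitable_E: "proper_U_suitable E"
  unfolding proper_U_suitable_def U_suitable_def
proof (intro conjI allI impI)
  let ?X = "closure (ext_pts (cball (0 :: 'a \<Rightarrow>\<^sub>L real) 1))"
  let ?L = "ev ` topspace K"
  show "closed E"
    unfolding E_def using compact_range_ev by (simp add: closed_Int compact_imp_closed)
  show "E \<subseteq> cball 0 1"
    unfolding E_def using norm_ev_le by auto
  show "E \<inter> uminus ` E \<inter> sphere 0 1 = {}"
  proof -
    have False if e: "e \<in> E" "e \<in> uminus ` E" "norm e = 1" for e
    proof -
      obtain s t where "s \<in> topspace K" "t \<in> topspace K" "e = ev s" "e = - ev t"
        using e(1,2) by (auto simp: E_def)
      then show False
        using ev_unit_not_minus[of s t] e(3) by (metis add.inverse_inverse)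
    qed
    then show ?thesis
      using mem_sphere_0 by blast
  qed
  have "closed (?L \<union> uminus ` ?L)"
    using compact_range_ev by (intro compact_imp_closed compact_Un compact_negations)
  then have "?X \<subseteq> ?L \<union> uminus ` ?L"
    using ext_pts_subset by (rule closure_minimal[rotated])
  moreover have "uminus ` E = uminus ` ?L \<inter> ?X"
    unfolding E_def by (subst image_Int) (auto simp: uminus_closure_ext_pts_ball)
  ultimately show "E \<union> uminus ` E = ?X"
    unfolding E_def by blast
  fix x :: 'a
  assume x: "norm x = 1"
  show "E \<inter> norming_set x = E \<inter> closure (ext_pts (norming_set x))"
  proof (rule antisym)
    show "E \<inter> norming_set x \<subseteq> E \<inter> closure (ext_pts (norming_set x))"
    proof
      fix e
      assume e: "e \<in> E \<inter> norming_set x"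
      then have "e \<in> ext_pts (cball 0 1)"
        using ev_unit_extreme by (auto simp: E_def norming_set_def)
      then have "e \<in> ext_pts (norming_set x)"
        using e extreme_point_of_face[OF norming_set_face_of[OF x]] by (simp add: ext_pts_def)
      then show "e \<in> E \<inter> closure (ext_pts (norming_set x))"
        using e closure_subset by blast
    qed
    have "ext_pts (norming_set x) \<subseteq> norming_set x"
      by (auto simp: ext_pts_def extreme_point_of_def)
    then have "closure (ext_pts (norming_set x)) \<subseteq> norming_set x"
      using closed_norming_set by (rule closure_minimal)
    then show "E \<inter> closure (ext_pts (norming_set x)) \<subseteq> E \<inter> norming_set x"
      by blast
  qed
qed

text \<open>Splitting an affine dependency by sign represents one vector \<open>y\<close> in two
  ways with equal mass. The face lies on the sphere, so this mass is \<open>norm y\<close>, and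
  uniqueness of extensions makes the two representations agree, coefficient by coefficient.\<close>

lemma affine_independent_face:
  fixes F :: "('a \<Rightarrow>\<^sub>L real) set"
  assumes F: "F face_of cball 0 1" "F \<noteq> cball 0 1"
  shows "\<not> affine_dependent (ext_pts F)"
proof
  assume "affine_dependent (ext_pts F)"
  then obtain S u where S: "finite S" "S \<subseteq> ext_pts F" "sum u S = 0" "\<exists>v\<in>S. u v \<noteq> 0"
    "(\<Sum>v\<in>S. u v *\<^sub>R v) = 0"
    unfolding affine_dependent_explicit by blast
  have Fs: "F \<subseteq> sphere 0 1"
    using F by (rule proper_face_of_ball_subset_sphere)
  have ext: "S \<subseteq> ext_pts (cball 0 1)" "S \<subseteq> F"
    using S(2) extreme_point_of_face[OF F(1)] by (auto simp: ext_pts_def)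
  have convF: "convex F"
    using F(1) by (rule face_of_imp_convex)
  define P where "P = {v \<in> S. u v > 0}"
  define N where "N = S - P"
  have PN: "finite P" "finite N" "P \<inter> N = {}" "S = P \<union> N"
    using S(1) by (auto simp: P_def N_def)
  define s where "s = sum u P"
  have N_sum: "(\<Sum>v\<in>N. - u v) = s"
    using S(3) PN by (simp add: s_def sum.union_disjoint sum_negf)
  have s: "s > 0"
  proof -
    have nonneg: "s \<ge> 0"
      unfolding s_def by (rule sum_nonneg) (simp add: P_def)
    moreover have "s \<noteq> 0"
    proof
      assume "s = 0"
      then have "\<forall>v\<in>P. u v = 0"
        using sum_nonneg_eq_0_iff[OF PN(1), of u] by (simp add: s_def P_def)
      moreover have "\<forall>v\<in>N. - u v = 0"
      proof -
        have "0 \<le> - u v" if "v \<in> N" for v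
          using that unfolding P_def N_def by auto
        from sum_nonneg_eq_0_iff[OF PN(2) this] show ?thesis
          using \<open>s = 0\<close> N_sum by simp
      qed
      ultimately show False
        using S(4) PN(4) by auto
    qed
    ultimately show ?thesis
      by simp
  qed
  define y where "y = (\<Sum>v\<in>P. u v *\<^sub>R v)"
  have y_N: "(\<Sum>v\<in>N. (- u v) *\<^sub>R v) = y"
    using S(5) PN by (simp add: y_def sum.union_disjoint sum_negf add_eq_0_iff)
  \<comment> \<open>Normalised by \<open>s\<close>, the positive part is a convex combination of
    points of \<open>F\<close>; this yields \<open>norm y = s\<close>.\<close>
  have "(\<Sum>v\<in>P. (u v / s) *\<^sub>R v) \<in> F"
    using PN(1) convF s ext(2)
    by (intro convex_sum) (auto simp: s_def P_def simp flip: sum_divide_distrib)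
  moreover have "(\<Sum>v\<in>P. (u v / s) *\<^sub>R v) = (1 / s) *\<^sub>R y"
    by (simp add: y_def scaleR_sum_right)
  ultimately have "norm ((1 / s) *\<^sub>R y) = 1"
    using Fs by (metis mem_sphere_0 subsetD)
  then have norm_y: "norm y = s"
    using s by (simp add: field_simps)
  have signed: "(\<Sum>v\<in>C. (c v * sg v) *\<^sub>R ev (pt v)) = (\<Sum>v\<in>C. c v *\<^sub>R v)" if "C \<subseteq> S" for C c
    using that ext(1) sg_ev by (intro sum.cong) (auto simp flip: scaleR_scaleR)
  have zero: "(\<Sum>v\<in>S. u v * sg v * f (pt v)) = 0" if f: "f \<in> CK K" for f
  proof -
    have "(\<Sum>v\<in>P. u v * sg v * f (pt v)) = (\<Sum>v\<in>N. (- u v * sg v) * f (pt v))"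
    proof (rule atomic_functionals_eq[OF _ _ _ _ f])
      show "(\<Sum>v\<in>P. (u v * sg v) *\<^sub>R ev (pt v)) = y"
        using PN(4) by (simp add: signed y_def)
      show "(\<Sum>v\<in>N. (- u v * sg v) *\<^sub>R ev (pt v)) = y"
        using PN(4) signed[of N "\<lambda>v. - u v"] y_N by simp
      show "(\<Sum>v\<in>P. \<bar>u v * sg v\<bar>) \<le> norm y"
        unfolding norm_y s_def by (intro sum_mono) (simp add: abs_mult P_def)
      show "(\<Sum>v\<in>N. \<bar>- u v * sg v\<bar>) \<le> norm y"
        unfolding norm_y N_sum[symmetric] by (intro sum_mono) (auto simp: abs_mult P_def N_def)
    qed
    then show ?thesis
      using PN by (simp add: sum.union_disjoint sum_negf)
  qed
  obtain v where v: "v \<in> S" "u v \<noteq> 0"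
    using S(4) by blast
  have sub: "pt ` S \<subseteq> topspace K"
    using ext(1) pt_in by blast
  \<comment> \<open>Two different extreme points over the same point of \<open>K\<close> would be
    opposite, and their midpoint \<open>0\<close> would lie in \<open>F\<close>, hence on the
    sphere.\<close>
  have inj: "pt w \<noteq> pt v" if w: "w \<in> S" "w \<noteq> v" for w
  proof
    assume eq: "pt w = pt v"
    have "sg w *\<^sub>R ev (pt w) = w" "sg v *\<^sub>R ev (pt v) = v"
      using w(1) v(1) ext(1) sg_ev by blast+
    then have "w = ev (pt v) \<or> w = - ev (pt v)" "v = ev (pt v) \<or> v = - ev (pt v)"
      using eq by (auto simp: sg_def split: if_splits)
    then have "w = - v"
      using w(2) by (metis minus_minus)
    then have "(1/2) *\<^sub>R v + (1/2) *\<^sub>R w = 0"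
      by simp
    moreover have "(1/2) *\<^sub>R v + (1/2) *\<^sub>R w \<in> F"
      using convF v(1) w(1) ext(2) by (intro convexD) auto
    ultimately show False
      using Fs by auto
  qed
  obtain f where f: "f \<in> CK K" "f (pt v) = 1" "\<And>t. t \<in> pt ` S \<Longrightarrow> t \<noteq> pt v \<Longrightarrow> f t = 0"
    using CK_peak[OF compact_K Hausdorff_K finite_imageI[OF S(1)] sub, of "pt v"] sub v(1) by blast
  have "(\<Sum>w\<in>S. u w * sg w * f (pt w)) = (\<Sum>w\<in>S. if w = v then u w * sg w else 0)"
    using f inj by (intro sum.cong) auto
  also have "\<dots> = u v * sg v"
    using S(1) v(1) by simp
  finally have "u v * sg v = 0"
    using zero[OF f(1)] by simp
  then show False
    using v(2) by (auto simp: sg_def split: if_splits)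
qed

lemma simplexoid_dual_ball: "simplexoid (cball (0 :: 'a \<Rightarrow>\<^sub>L real) 1)"
  unfolding simplexoid_def
proof (intro conjI allI impI)
  fix F :: "('a \<Rightarrow>\<^sub>L real) set"
  assume F: "F face_of cball 0 1 \<and> F \<noteq> cball 0 1 \<and> closed F"
  then have "compact F"
    using compact_dual_ball[OF findim] face_of_imp_subset
    by (metis closed_Int_compact inf.absorb1)
  then have "F = convex hull ext_pts F"
    using F face_of_imp_convex by (intro Krein_Milman_Minkowski_dual[OF findim]) auto
  then show "is_simplex F"
    unfolding is_simplex_def
    using F affine_independent_face finite_affine_independent_dual[OF findim] by blast
qed (use compact_dual_ball[OF findim] in auto)

end

text \<open>The dual ball is \<open>{0}\<close> and has no unit vectors, so (i) and (iii) hold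
  vacuously; its only proper face is empty, the hull of no points.\<close>

lemma trivial_dual:
  assumes "\<forall>x::'a::real_normed_vector. x = 0"
  shows "proper_U_suitable {0 :: 'a \<Rightarrow>\<^sub>L real}" "simplexoid (cball (0 :: 'a \<Rightarrow>\<^sub>L real) 1)"
proof -
  have "f = 0" for f :: "'a \<Rightarrow>\<^sub>L real"
    by (rule blinfun_eqI) (metis assms blinfun.zero_left blinfun.zero_right)
  then have ball: "cball (0 :: 'a \<Rightarrow>\<^sub>L real) 1 = {0}"
    by auto
  have "ext_pts {0 :: 'a \<Rightarrow>\<^sub>L real} = {0}"
    by (auto simp: ext_pts_def extreme_point_of_def)
  then show "proper_U_suitable {0 :: 'a \<Rightarrow>\<^sub>L real}"
    using assms by (simp add: proper_U_suitable_def U_suitable_def ball) (metis norm_zero zero_neq_one)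
  have "is_simplex ({} :: ('a \<Rightarrow>\<^sub>L real) set)"
    unfolding is_simplex_def by (intro exI[of _ "{}"]) auto
  then show "simplexoid (cball (0 :: 'a \<Rightarrow>\<^sub>L real) 1)"
    unfolding simplexoid_def ball using face_of_imp_subset
    by (metis compact_sing convex_singleton subset_singletonD)
qed

section \<open>Sufficiency\<close>

locale suitable_simplexoid =
  fixes E :: "('a::real_normed_vector \<Rightarrow>\<^sub>L real) set"
  assumes findim: "\<exists>B. finite B \<and> span B = (UNIV :: 'a set)"
    and E: "proper_U_suitable E" and simplexoid: "simplexoid (cball (0 :: 'a \<Rightarrow>\<^sub>L real) 1)"
begin

lemma closed_E: "closed E" and E_subset: "E \<subseteq> cball 0 1"
  and E_antisym: "E \<inter> uminus ` E \<inter> sphere 0 1 = {}"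
  and E_cover: "E \<union> uminus ` E = closure (ext_pts (cball 0 1))"
  and E_proper: "norm x = 1 \<Longrightarrow> E \<inter> norming_set x = E \<inter> closure (ext_pts (norming_set x))"
  using E unfolding proper_U_suitable_def U_suitable_def by auto

text \<open>The value \<open>0\<close> off \<open>E\<close> is the normalisation demanded by
  \<open>CK\<close>.\<close>

definition restr :: "'a \<Rightarrow> ('a \<Rightarrow>\<^sub>L real) \<Rightarrow> real" where
  "restr x f = (if f \<in> E then blinfun_apply f x else 0)"

abbreviation KE :: "('a \<Rightarrow>\<^sub>L real) topology" where
  "KE \<equiv> top_of_set E"

lemma compact_KE: "compact_space KE"
proof -
  have "compact E"
    using closed_E E_subset compact_dual_ball[OF findim] by (metis closed_Int_compact inf.absorb1)
  then show ?thesis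
    by (simp add: compact_space_subtopology)
qed

lemma Hausdorff_KE: "Hausdorff_space KE"
  by (simp add: Hausdorff_space_subtopology)

lemma restr_in_CK: "restr x \<in> CK KE"
proof -
  have "continuous_map KE euclideanreal (\<lambda>f. blinfun_apply f x)"
    by (simp add: linear_continuous_on blinfun.bounded_linear_left)
  from CK_restrict[OF this] show ?thesis
    by (simp add: restr_def[abs_def])
qed

lemma norming_set_simplex:
  fixes x :: 'a
  assumes "norm x = 1"
  shows "is_simplex (norming_set x)"
proof -
  have "0 \<notin> norming_set x"
    by (simp add: norming_set_def)
  then have "norming_set x \<noteq> cball 0 1"
    by (metis centre_in_cball zero_le_one)
  then show ?thesis
    using simplexoid norming_set_face_of[OF assms] closed_norming_set unfolding simplexoid_def
    by blast
qed

text \<open>A simplex has finitely many extreme points, so the closure in condition (iii) adds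
  nothing and (iii) puts \<open>f\<close> among them.\<close>

lemma E_norming_extreme:
  assumes "norm x = 1" "f \<in> E" "f \<in> norming_set x"
  shows "f extreme_point_of cball 0 1"
proof -
  obtain C where C: "finite C" "norming_set x = convex hull C"
    using norming_set_simplex[OF assms(1)] unfolding is_simplex_def by blast
  have "ext_pts (norming_set x) \<subseteq> C"
    using C(2) extreme_point_of_convex_hull by (auto simp: ext_pts_def)
  then have "closed (ext_pts (norming_set x))"
    using C(1) finite_imp_closed finite_subset by blast
  then have "f \<in> ext_pts (norming_set x)"
    using E_proper[OF assms(1)] assms(2,3) by (metis IntD2 IntI closure_closed)
  then show ?thesis
    using extreme_point_of_face[OF norming_set_face_of[OF assms(1)]] by (simp add: ext_pts_def)
qed

text \<open>For the value -1 the previous lemma is applied at \<open>- x\<close> and the result is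
  reflected through the origin.\<close>

lemma signed_extreme:
  assumes x: "norm x = 1" and f: "f \<in> E" "\<bar>blinfun_apply f x\<bar> = 1"
  shows "blinfun_apply f x *\<^sub>R f \<in> ext_pts (norming_set x)"
proof -
  have nf: "norm f \<le> 1"
    using f(1) E_subset by auto
  consider "blinfun_apply f x = 1" | "blinfun_apply f x = - 1"
    using f(2) by linarith
  then show ?thesis
  proof cases
    case 1
    then have "f \<in> norming_set x"
      using nf by (simp add: norming_set_eq[OF x])
    then show ?thesis
      using 1 E_norming_extreme[OF x f(1)] extreme_point_of_face[OF norming_set_face_of[OF x]]
      by (simp add: ext_pts_def)
  next
    case 2
    have x': "norm (- x) = 1"
      using x by simp
    have "f \<in> norming_set (- x)"
      using nf 2 by (simp add: norming_set_eq[OF x'] blinfun.minus_right)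
    then have "- f extreme_point_of cball 0 1"
      using E_norming_extreme[OF x' f(1)] extreme_point_of_ball_minus by blast
    moreover have "- f \<in> norming_set x"
      using nf 2 by (simp add: norming_set_eq[OF x] blinfun.minus_left)
    ultimately show ?thesis
      using 2 extreme_point_of_face[OF norming_set_face_of[OF x]] by (simp add: ext_pts_def)
  qed
qed

text \<open>For the lower bound, the norming set of the normalised vector is nonempty and compact,
  so it has an extreme point \<open>e\<close>. This is extreme in the ball, hence \<open>e\<close>
  or \<open>- e\<close> belongs to \<open>E\<close>.\<close>

lemma supnorm_restr: "supnorm KE (restr x) = norm x"
proof (rule antisym)
  show "supnorm KE (restr x) \<le> norm x"
  proof (rule supnorm_le)
    fix f
    assume "f \<in> topspace KE"
    then have "norm f \<le> 1"
      using E_subset by auto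
    then have "norm f * norm x \<le> 1 * norm x"
      by (intro mult_right_mono) auto
    then show "\<bar>restr x f\<bar> \<le> norm x"
      using norm_blinfun[of f x] by (auto simp: restr_def)
  qed simp
  show "norm x \<le> supnorm KE (restr x)"
  proof (cases "x = 0")
    case True
    then show ?thesis
      using supnorm_nonneg[OF compact_KE restr_in_CK] by simp
  next
    case False
    define u where "u = (1 / norm x) *\<^sub>R x"
    have u: "norm u = 1"
      using False by (simp add: u_def)
    have face: "norming_set u face_of cball 0 1"
      by (rule norming_set_face_of[OF u])
    have "compact (norming_set u)"
      using closed_norming_set compact_dual_ball[OF findim] face_of_imp_subset[OF face]
      by (metis closed_Int_compact inf.absorb1)
    then have "norming_set u = convex hull ext_pts (norming_set u)"
      using face_of_imp_convex[OF face] by (rule Krein_Milman_Minkowski_dual[OF findim])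
    moreover have "norming_set u \<noteq> {}"
      using ex_norming_functional[OF findim u] by blast
    ultimately obtain e where e: "e extreme_point_of norming_set u"
      by (fastforce simp: ext_pts_def)
    then have "e \<in> closure (ext_pts (cball 0 1))"
      using extreme_point_of_face[OF face] closure_subset by (fastforce simp: ext_pts_def)
    then have "e \<in> E \<or> - e \<in> E"
      using E_cover by fastforce
    moreover have "blinfun_apply e x = norm x"
    proof -
      have "blinfun_apply e u = 1"
        using e by (auto simp: extreme_point_of_def norming_set_def)
      then show ?thesis
        using False by (simp add: u_def blinfun.scaleR_right field_simps)
    qed
    ultimately have "\<exists>f\<in>E. \<bar>restr x f\<bar> = norm x"
      by (auto simp: restr_def blinfun.minus_left intro: bexI[of _ e] bexI[of _ "- e"])
    then show ?thesis
      using abs_le_supnorm[OF compact_KE restr_in_CK] by metis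
  qed
qed

lemma ex_extension:
  obtains y where "y \<in> CK_dual KE" "\<And>x. y (restr x) = blinfun_apply x' x"
    "CK_dual_norm KE y = norm x'"
proof -
  obtain A c where A: "finite A" "A \<subseteq> ext_pts (cball (0 :: 'a \<Rightarrow>\<^sub>L real) 1)"
    "\<forall>w\<in>A. 0 \<le> c w" "sum c A = norm x'" "(\<Sum>w\<in>A. c w *\<^sub>R w) = x'"
    using dual_ball_combination[OF findim, of x'] by blast
  \<comment> \<open>The sign moves each extreme point \<open>w\<close> into \<open>E\<close>; it
    occurs once in the coefficient and once in the point, so it cancels on
    \<open>restr x\<close>.\<close>
  define e where "e w = (if w \<in> E then 1 else - 1 :: real)" for w
  have in_E: "e w *\<^sub>R w \<in> E" if "w \<in> A" for w
  proof -
    have "w \<in> E \<union> uminus ` E"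
      using that A(2) closure_subset unfolding E_cover by blast
    then show ?thesis
      by (auto simp: e_def)
  qed
  define y where "y f = (\<Sum>w\<in>A. (c w * e w) * f (e w *\<^sub>R w))" for f :: "('a \<Rightarrow>\<^sub>L real) \<Rightarrow> real"
  have dual: "y \<in> CK_dual KE"
    unfolding y_def[abs_def] by (rule atomic_functional_in_CK_dual[OF compact_KE])
  have ext: "y (restr x) = blinfun_apply x' x" for x
  proof -
    have "y (restr x) = (\<Sum>w\<in>A. c w * blinfun_apply w x)"
      unfolding y_def using in_E
      by (intro sum.cong) (auto simp: restr_def blinfun.scaleR_left e_def)
    then show ?thesis
      by (simp add: A(5)[symmetric] blinfun.sum_left blinfun.scaleR_left)
  qed
  have "(\<Sum>w\<in>A. \<bar>c w * e w\<bar>) = norm x'"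
    unfolding A(4)[symmetric] using A(3) by (intro sum.cong) (auto simp: e_def)
  then have bound: "\<bar>y f\<bar> \<le> norm x' * supnorm KE f" if "f \<in> CK KE" for f
    using atomic_functional_bound[OF compact_KE that, of "\<lambda>w. c w * e w" "\<lambda>w. e w *\<^sub>R w" A]
    unfolding y_def by metis
  have "CK_dual_norm KE y = norm x'"
    by (rule CK_dual_norm_extension[where T = restr, OF compact_KE restr_in_CK supnorm_restr dual ext bound])
  with dual ext show ?thesis
    by (rule that)
qed

text \<open>Both extensions attain their norm at \<open>restr x\<close>, so both are carried by the
  set \<open>Z\<close>. The signed points \<open>w t\<close> are distinct vertices of one simplex,
  and both coefficient families represent \<open>x'\<close> on them with the same total
  mass.\<close>

lemma extension_unique:
  assumes y: "y \<in> CK_dual KE" "\<And>x. y (restr x) = blinfun_apply x' x" "CK_dual_norm KE y = norm x'"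
    and z: "z \<in> CK_dual KE" "\<And>x. z (restr x) = blinfun_apply x' x" "CK_dual_norm KE z = norm x'"
    and f: "f \<in> CK KE"
  shows "z f = y f"
proof (cases "x' = 0")
  case True
  then show ?thesis
    using CK_dual_bound[OF compact_KE y(1) f] CK_dual_bound[OF compact_KE z(1) f] y(3) z(3) by simp
next
  case False
  obtain x where x: "norm x = 1" "blinfun_apply x' x = norm x'"
    using norm_attained[OF findim False] by metis
  obtain C where C: "finite C" "\<not> affine_dependent C" "norming_set x = convex hull C"
    using norming_set_simplex[OF x(1)] unfolding is_simplex_def by blast
  have extC: "ext_pts (norming_set x) \<subseteq> C"
    using C(3) extreme_point_of_convex_hull by (auto simp: ext_pts_def)
  define Z where "Z = {t \<in> topspace KE. \<bar>restr x t\<bar> = 1}"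
  define w where "w t = restr x t *\<^sub>R t" for t
  have wC: "w t \<in> C" if "t \<in> Z" for t
    using that signed_extreme[OF x(1), of t] extC by (auto simp: Z_def w_def restr_def)
  have inj: "inj_on w Z"
  proof (rule inj_onI)
    fix s t
    assume st: "s \<in> Z" "t \<in> Z" "w s = w t"
    have n: "norm t = 1"
    proof -
      have "norm (w t) = 1"
        using st(2) signed_extreme[OF x(1), of t]
        by (auto simp: Z_def w_def restr_def ext_pts_def extreme_point_of_def norming_set_def)
      then show ?thesis
        using st(2) by (simp add: Z_def w_def)
    qed
    have "restr x s = 1 \<or> restr x s = - 1" "restr x t = 1 \<or> restr x t = - 1"
      using st(1,2) by (auto simp: Z_def)
    then have "s = t \<or> t = - s"
      using st(3) by (auto simp: w_def)
    \<comment> \<open>Condition (i) enters here: a unit vector and its negative cannot both lie in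
      \<open>E\<close>.\<close>
    moreover have "t \<noteq> - s"
      using E_antisym n st(1,2) by (auto simp: Z_def)
    ultimately show "s = t"
      by blast
  qed
  have fin: "finite Z"
    using inj wC C(1) by (meson finite_imageD finite_subset image_subsetI)
  have le1: "\<bar>restr x t\<bar> \<le> 1" for t
    using abs_le_supnorm[OF compact_KE restr_in_CK, of x t] supnorm_restr x(1) by simp
  obtain a where a: "\<And>h. h \<in> CK KE \<Longrightarrow> y h = (\<Sum>t\<in>Z. a t * (restr x t * h t))"
    by (rule norm_attaining_functional_atomic[OF compact_KE Hausdorff_KE y(1) restr_in_CK, of x Z])
       (use le1 y x Z_def fin in auto)
  obtain b where b: "\<And>h. h \<in> CK KE \<Longrightarrow> z h = (\<Sum>t\<in>Z. b t * (restr x t * h t))"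
    by (rule norm_attaining_functional_atomic[OF compact_KE Hausdorff_KE z(1) restr_in_CK, of x Z])
       (use le1 z x Z_def fin in auto)
  \<comment> \<open>Testing against \<open>x\<close> itself gives the mass, because each
    \<open>restr x t\<close> squares to 1 on \<open>Z\<close>; testing against all vectors gives the
    combination.\<close>
  have total: "sum c Z = norm x'" and bary: "(\<Sum>t\<in>Z. c t *\<^sub>R w t) = x'"
    if c: "\<And>v. blinfun_apply x' v = (\<Sum>t\<in>Z. c t * (restr x t * restr v t))" for c
  proof -
    have "sum c Z = (\<Sum>t\<in>Z. c t * (restr x t * restr x t))"
    proof (intro sum.cong refl)
      fix t
      assume "t \<in> Z"
      then have "restr x t * restr x t = 1"
        using abs_mult_self_eq[of "restr x t"] by (simp add: Z_def)
      then show "c t = c t * (restr x t * restr x t)"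
        by simp
    qed
    then show "sum c Z = norm x'"
      using c[of x] x(2) by simp
    have "blinfun_apply (\<Sum>t\<in>Z. c t *\<^sub>R w t) v = blinfun_apply x' v" for v
    proof -
      have "blinfun_apply (\<Sum>t\<in>Z. c t *\<^sub>R w t) v = (\<Sum>t\<in>Z. c t * (restr x t * restr v t))"
        by (auto simp: blinfun.sum_left blinfun.scaleR_left w_def restr_def Z_def intro!: sum.cong)
      then show ?thesis
        using c by simp
    qed
    then show "(\<Sum>t\<in>Z. c t *\<^sub>R w t) = x'"
      by (rule blinfun_eqI)
  qed
  have ya: "blinfun_apply x' v = (\<Sum>t\<in>Z. a t * (restr x t * restr v t))" for v
    using a[OF restr_in_CK] y(2) by metis
  have zb: "blinfun_apply x' v = (\<Sum>t\<in>Z. b t * (restr x t * restr v t))" for v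
    using b[OF restr_in_CK] z(2) by metis
  have "a t = b t" if t: "t \<in> Z" for t
  proof (rule ccontr)
    assume ne: "a t \<noteq> b t"
    \<comment> \<open>The coefficient differences are transported to the vertices; they form an
      affine dependency of \<open>C\<close>.\<close>
    define u where "u v = a (the_inv_into Z w v) - b (the_inv_into Z w v)" for v
    have u_w: "u (w s) = a s - b s" if "s \<in> Z" for s
      using the_inv_into_f_f[OF inj that] by (simp add: u_def)
    have "sum u (w ` Z) = (\<Sum>s\<in>Z. a s - b s)"
      using u_w by (simp add: sum.reindex[OF inj])
    then have 1: "sum u (w ` Z) = 0"
      using total[OF ya] total[OF zb] by (simp add: sum_subtractf)
    have "(\<Sum>v\<in>w ` Z. u v *\<^sub>R v) = (\<Sum>s\<in>Z. (a s - b s) *\<^sub>R w s)"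
      using u_w by (simp add: sum.reindex[OF inj])
    then have 2: "(\<Sum>v\<in>w ` Z. u v *\<^sub>R v) = 0"
      using bary[OF ya] bary[OF zb] by (simp add: scaleR_diff_left sum_subtractf)
    have 3: "\<exists>v\<in>w ` Z. u v \<noteq> 0"
      using t u_w ne by auto
    have "affine_dependent C"
      unfolding affine_dependent_explicit using fin wC 1 2 3
      by (intro exI[of _ "w ` Z"] exI[of _ u]) auto
    with C(2) show False ..
  qed
  then show ?thesis
    using a[OF f] b[OF f] by simp
qed

lemma U_embedding_restr: "U_embedding_CK KE restr"
  unfolding U_embedding_CK_def
proof (intro conjI allI)
  fix x' :: "'a \<Rightarrow>\<^sub>L real"
  obtain y where y: "y \<in> CK_dual KE" "\<And>x. y (restr x) = blinfun_apply x' x"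
    "CK_dual_norm KE y = norm x'"
    using ex_extension by blast
  show "\<exists>y'\<in>CK_dual KE. (\<forall>x. y' (restr x) = blinfun_apply x' x) \<and> CK_dual_norm KE y' = norm x' \<and>
      (\<forall>z'\<in>CK_dual KE. (\<forall>x. z' (restr x) = blinfun_apply x' x) \<and> CK_dual_norm KE z' = norm x' \<longrightarrow>
         (\<forall>f\<in>CK KE. z' f = y' f))"
    using y extension_unique[OF y] by (intro bexI[of _ y]) auto
qed (auto simp: restr_in_CK supnorm_restr restr_def blinfun.add_right blinfun.scaleR_right)

end

text \<open>The equivalence is split because the type of points differs: it is arbitrary in the
  first implication, while the space built in the second is a subset of the dual.\<close>

theorem theorem6p7:
  fixes X_type :: "'a::banach itself" and K_type :: "'k itself"
  assumes findim: "\<exists>B. finite B \<and> span B = (UNIV :: 'a set)"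
  shows "((\<exists>(K::'k topology) (T::'a \<Rightarrow> ('k \<Rightarrow> real)).
             compact_space K \<and> Hausdorff_space K \<and> U_embedding_CK K T)
          \<longrightarrow> (\<exists>E::('a \<Rightarrow>\<^sub>L real) set. proper_U_suitable E) \<and> simplexoid (cball (0::'a \<Rightarrow>\<^sub>L real) 1))
       \<and> ((\<exists>E::('a \<Rightarrow>\<^sub>L real) set. proper_U_suitable E) \<and> simplexoid (cball (0::'a \<Rightarrow>\<^sub>L real) 1)
          \<longrightarrow> (\<exists>(K::('a \<Rightarrow>\<^sub>L real) topology) (T::'a \<Rightarrow> (('a \<Rightarrow>\<^sub>L real) \<Rightarrow> real)).
             compact_space K \<and> Hausdorff_space K \<and> U_embedding_CK K T))"
proof (intro conjI impI)
  assume "\<exists>(K::'k topology) (T::'a \<Rightarrow> ('k \<Rightarrow> real)).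
    compact_space K \<and> Hausdorff_space K \<and> U_embedding_CK K T"
  then obtain K :: "'k topology" and T :: "'a \<Rightarrow> ('k \<Rightarrow> real)"
    where KT: "compact_space K" "Hausdorff_space K" "U_embedding_CK K T"
    by blast
  have "(\<exists>E::('a \<Rightarrow>\<^sub>L real) set. proper_U_suitable E) \<and> simplexoid (cball (0::'a \<Rightarrow>\<^sub>L real) 1)"
  proof (cases "\<forall>x::'a. x = 0")
    case True
    then show ?thesis
      using trivial_dual by blast
  next
    case False
    then interpret U_embedded K T
      using findim KT by unfold_locales auto
    show ?thesis
      using proper_U_suitable_E simplexoid_dual_ball by blast
  qed
  then show "\<exists>E::('a \<Rightarrow>\<^sub>L real) set. proper_U_suitable E"
    and "simplexoid (cball (0::'a \<Rightarrow>\<^sub>L real) 1)"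
    by blast+
next
  assume "(\<exists>E::('a \<Rightarrow>\<^sub>L real) set. proper_U_suitable E) \<and> simplexoid (cball (0::'a \<Rightarrow>\<^sub>L real) 1)"
  then obtain E :: "('a \<Rightarrow>\<^sub>L real) set" where
    "proper_U_suitable E" "simplexoid (cball (0::'a \<Rightarrow>\<^sub>L real) 1)"
    by blast
  then interpret suitable_simplexoid E
    using findim by unfold_locales
  show "\<exists>(K::('a \<Rightarrow>\<^sub>L real) topology) (T::'a \<Rightarrow> (('a \<Rightarrow>\<^sub>L real) \<Rightarrow> real)).
      compact_space K \<and> Hausdorff_space K \<and> U_embedding_CK K T"
    using compact_KE Hausdorff_KE U_embedding_restr by blast
qed

end
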